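(* Let $(V,q)$ be a $4$-dimensional Minkowski space and let $\phi : V\to V$ be a continuous coherency preserver. Then $\phi$ is an affine similarity of $(V,q)$ or $\phi$ is degenerate.
   Context: A Minkowski space is a pair $(V,q)$ where $V$ is a finite-dimensional real vector space of dimension $n>1$ and $q$ is a quadratic form on $V$ of signature $(1,n-1)$; $V$ carries its standard (vector space) topology. Two points $x,y\in V$ are coherent when $q(x-y)=0$. For $a\in V$, the coherency cone of $a$ is $\mathcal{C}(a)=\{m\in V: q(m-a)=0\}$. A coherency preserver is a map $\phi:V\to V$ such that $q(b-a)=0$ implies $q(\phi(b)-\phi(a))=0$ for all $a,b\in V$; it is degenerate when its range is included in some coherency cone $\mathcal{C}(a)$. A linear similarity of $(V,q)$ is a bijective linear map $u:V\to V$ for which there is a nonzero scalar $\lambda$ with $q(u(x))=\lambda q(x)$ for all $x\in V$; an affine similarity is the composite of a linear similarity with a translation. *)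

theory Defs
  imports "HOL-Analysis.Analysis"
begin

definition minkowski_form :: "('v::euclidean_space \<Rightarrow> real) \<Rightarrow> bool" where
  "minkowski_form q \<longleftrightarrow> DIM('v) > 1 \<and>
     (\<exists>b :: nat \<Rightarrow> 'v.
        independent (b ` {..<DIM('v)}) \<and> inj_on b {..<DIM('v)} \<and>
        span (b ` {..<DIM('v)}) = UNIV \<and>
        (\<forall>c :: nat \<Rightarrow> real. q (\<Sum>i<DIM('v). c i *\<^sub>R b i)
            = (c 0)\<^sup>2 - (\<Sum>i\<in>{1..<DIM('v)}. (c i)\<^sup>2)))"

definition coherency_cone :: "('v::real_vector \<Rightarrow> real) \<Rightarrow> 'v \<Rightarrow> 'v set" where
  "coherency_cone q a = {m. q (m - a) = 0}"

definition coherency_preserver :: "('v::real_vector \<Rightarrow> real) \<Rightarrow> ('v \<Rightarrow> 'v) \<Rightarrow> bool" where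
  "coherency_preserver q \<phi> \<longleftrightarrow> (\<forall>a b. q (b - a) = 0 \<longrightarrow> q (\<phi> b - \<phi> a) = 0)"

definition degenerate :: "('v::real_vector \<Rightarrow> real) \<Rightarrow> ('v \<Rightarrow> 'v) \<Rightarrow> bool" where
  "degenerate q \<phi> \<longleftrightarrow> (\<exists>a. range \<phi> \<subseteq> coherency_cone q a)"

definition linear_similarity :: "('v::real_vector \<Rightarrow> real) \<Rightarrow> ('v \<Rightarrow> 'v) \<Rightarrow> bool" where
  "linear_similarity q u \<longleftrightarrow> linear u \<and> bij u \<and>
     (\<exists>l::real. l \<noteq> 0 \<and> (\<forall>x. q (u x) = l * q x))"

definition affine_similarity :: "('v::real_vector \<Rightarrow> real) \<Rightarrow> ('v \<Rightarrow> 'v) \<Rightarrow> bool" where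
  "affine_similarity q \<phi> \<longleftrightarrow> (\<exists>u c. linear_similarity q u \<and> \<phi> = (\<lambda>x. u x + c))"

end

theory Submission
  imports Defs
begin

text \<open>
  Let \<open>\<phi>\<close> be nondegenerate. Three pairwise coherent points lie on a light line, so \<open>\<phi>\<close> maps light lines
  into light lines, and nondegeneracy makes it nonconstant on each of them. If \<open>\<phi>\<close> identified two points
  of a light line, the direction of the image line would be locally constant, hence constant, on the cones
  of these points; this collapse propagates and contradicts nondegeneracy. So \<open>\<phi>\<close> is injective on light
  lines, then injective, and it reflects coherency. A limit argument along a light line shows that light
  lines are mapped onto light lines, and with invariance of domain \<open>\<phi>\<close> is bijective. Disjoint null
  hyperplanes then have disjoint images, so parallel light lines stay parallel; parallelograms of null
  vectors are preserved, whence \<open>\<phi>\<close> is additive up to a translation, and by continuity affine.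
\<close>

section \<open>Geometry of the null cone\<close>

text \<open>Coordinate-free Lorentzian geometry: \<open>null_orthogonal\<close> encodes the
  signature, since the orthogonal complement of a null line is negative semidefinite and degenerates
  only along that line.\<close>

locale minkowski_space =
  fixes B :: "'v::euclidean_space \<Rightarrow> 'v \<Rightarrow> real"
  assumes bilinear: "bilinear B"
    and sym: "B x y = B y x"
    and nondegenerate: "x \<noteq> 0 \<Longrightarrow> \<exists>y. B x y \<noteq> 0"
    and null_orthogonal: "\<lbrakk>B x x = 0; x \<noteq> 0; B x y = 0\<rbrakk> \<Longrightarrow> B y y < 0 \<or> (\<exists>k. y = k *\<^sub>R x)"
    and ex_null: "\<exists>x. x \<noteq> 0 \<and> B x x = 0"
    and dim_ge_3: "DIM('v) \<ge> 3"
begin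

sublocale B: bounded_bilinear B
  using bilinear by (simp add: bilinear_conv_bounded_bilinear)

abbreviation q :: "'v \<Rightarrow> real" where "q x \<equiv> B x x"

lemmas expand = B.add_left B.add_right B.diff_left B.diff_right B.scaleR_left B.scaleR_right
  B.minus_left B.minus_right B.zero_left B.zero_right

declare B.zero_left [simp] B.zero_right [simp]

lemma q_add: "q (x + y) = q x + 2 * B x y + q y"
  using sym[of x y] by (simp add: expand)

lemma q_diff: "q (x - y) = q x - 2 * B x y + q y"
  using sym[of x y] by (simp add: expand)

lemma q_scale: "q (t *\<^sub>R x) = t\<^sup>2 * q x"
  by (simp add: expand power2_eq_square)

lemma q_minus_commute: "q (x - y) = q (y - x)"
  by (simp add: expand)

lemma null_parallel:
  assumes "q x = 0" "q y = 0" "B x y = 0" "x \<noteq> 0"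
  shows "\<exists>k. y = k *\<^sub>R x"
  using null_orthogonal[of x y] assms by auto

lemma null_triangle:
  assumes "q u = 0" "q v = 0" "q (u - v) = 0" "u \<noteq> 0"
  shows "\<exists>k. v = k *\<^sub>R u"
proof -
  have "B u v = 0" using assms sym[of v u] by (simp add: expand)
  then show ?thesis using null_parallel assms by blast
qed

text \<open>Since \<open>d\<close> is null, \<open>q\<close> is affine in the parameter along
  \<open>a + \<real>d\<close>, so this light line carries exactly one point coherent to
  \<open>c\<close>. Later constructions project points to light lines in this way.\<close>

lemma foot_coherent:
  assumes "q d = 0" "B (c - a) d \<noteq> 0"
  shows "q (c - (a + (q (c - a) / (2 * B (c - a) d)) *\<^sub>R d)) = 0"
proof -
  have "q (x - t *\<^sub>R d) = q x - 2 * t * B x d" for x t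
    using assms(1) sym[of d x] by (simp add: expand)
  from this[of "c - a"] show ?thesis using assms(2) by (simp add: diff_diff_eq)
qed

lemma ex_null_partner:
  assumes "q g = 0" "g \<noteq> 0"
  obtains h where "q h = 0" "B g h > 0"
proof -
  obtain w where w: "B g w \<noteq> 0" using nondegenerate assms by blast
  define h where "h = w - (q w / (2 * B g w)) *\<^sub>R g"
  have h: "q h = 0" "B g h = B g w" unfolding h_def using assms w sym[of w g] by (auto simp: expand)
  show thesis
  proof (cases "B g h > 0")
    case True then show thesis using that h by blast
  next
    case False
    then have "q (- h) = 0" "B g (- h) > 0" using h w by (auto simp: expand)
    then show thesis using that by blast
  qed
qed

lemma ex_not_in_span:
  fixes e f :: 'v
  obtains k where "k \<notin> span {e, f}"
proof -
  have "dim (span {e, f}) \<le> card {e, f}" by (metis dim_le_card' dim_span finite.emptyI finite.insertI)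
  also have "\<dots> \<le> 2" by (simp add: card_insert_if)
  finally have "dim (span {e, f}) < DIM('v)" using dim_ge_3 by linarith
  then have "span {e, f} \<noteq> UNIV" by (metis dim_UNIV less_irrefl)
  then show thesis using that by blast
qed

text \<open>A vector outside the plane of \<open>e\<close> and \<open>f\<close>, projected off that
  plane, is nonzero and orthogonal to \<open>e\<close>, hence negative. The normalization makes the
  conic \<open>(1 - t)^2 e + t (1 - t) v + t^2 f\<close> null.\<close>

lemma ex_perp:
  assumes "q e = 0" "q f = 0" "B e f > 0"
  obtains v where "B e v = 0" "B f v = 0" "q v = - 2 * B e f"
proof -
  obtain k where k: "k \<notin> span {e, f}" using ex_not_in_span by blast
  define v where "v = k - (B k f / B e f) *\<^sub>R e - (B k e / B e f) *\<^sub>R f"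
  have ev: "B e v = 0" and fv: "B f v = 0"
    unfolding v_def using assms sym[of f e] sym[of k f] sym[of k e] by (auto simp: expand)
  have e0: "e \<noteq> 0" using assms(3) by (auto simp: expand)
  have "v \<noteq> j *\<^sub>R e" for j
  proof
    assume "v = j *\<^sub>R e"
    then have "k = (j + B k f / B e f) *\<^sub>R e + (B k e / B e f) *\<^sub>R f"
      unfolding v_def by (simp add: algebra_simps)
    also have "\<dots> \<in> span {e, f}" by (intro span_add span_scale span_base) auto
    finally show False using k by simp
  qed
  then have neg: "q v < 0" using null_orthogonal[of e v] assms(1) e0 ev by blast
  define r where "r = sqrt (2 * B e f / (- q v))"
  have "r\<^sup>2 = 2 * B e f / (- q v)" unfolding r_def using neg assms(3) by (intro real_sqrt_pow2 divide_nonneg_pos) auto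
  then have "q (r *\<^sub>R v) = - 2 * B e f"
    using neg by (simp add: expand power2_eq_square[symmetric] field_simps) (simp add: power2_eq_square algebra_simps)
  then show thesis using that[of "r *\<^sub>R v"] ev fv by (simp add: expand)
qed

lemma perp_decomposition:
  assumes "q e = 0" "q f = 0" "B e f \<noteq> 0"
  obtains \<alpha> \<beta> v where "x = \<alpha> *\<^sub>R e + \<beta> *\<^sub>R f + v" "B e v = 0" "B f v = 0"
proof
  define v where "v = x - (B x f / B e f) *\<^sub>R e - (B x e / B e f) *\<^sub>R f"
  show "x = (B x f / B e f) *\<^sub>R e + (B x e / B e f) *\<^sub>R f + v" by (simp add: v_def)
  show "B e v = 0" "B f v = 0"
    unfolding v_def using assms sym[of f e] sym[of x f] sym[of x e] by (auto simp: expand)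
qed

text \<open>If \<open>B _ w\<close> vanished on all null vectors near \<open>g\<close>, expanding it
  along null curves through \<open>g\<close> would make \<open>w\<close> orthogonal to everything.
  Generic choices of light directions come from this.\<close>

lemma ex_generic_null_near:
  assumes "q g = 0" "g \<noteq> 0" "w \<noteq> 0" "open U" "g \<in> U"
  obtains g' where "g' \<in> U" "q g' = 0" "B g' w \<noteq> 0"
proof (rule ccontr)
  note ex = that
  assume "\<not> thesis"
  then have zero: "B g' w = 0" if "g' \<in> U" "q g' = 0" for g' using that ex by blast
  obtain h where h: "q h = 0" "B g h > 0" using ex_null_partner assms by blast
  have perp: "B v w = 0 \<and> q v * B h w = 0" if v: "B g v = 0" "B h v = 0" for v
  proof -
    \<comment> \<open>A parabola inside the null cone through \<open>g\<close> with velocity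
      \<open>v\<close>; the \<open>h\<close> term cancels \<open>t\<^sup>2 * q v\<close>.\<close>
    define c where "c t = g + t *\<^sub>R v - (t\<^sup>2 * q v / (2 * B g h)) *\<^sub>R h" for t
    have null: "q (c t) = 0" for t
      unfolding c_def using v h assms(1) sym[of h g] sym[of v g] sym[of v h]
      by (simp add: expand power2_eq_square field_simps)
    have "(c \<longlongrightarrow> c 0) (nhds 0)"
      unfolding c_def using h by (intro tendsto_intros filterlim_ident) auto
    then have "(c \<longlongrightarrow> g) (nhds 0)" by (simp add: c_def)
    then have "\<forall>\<^sub>F t in nhds 0. c t \<in> U" using assms by (intro topological_tendstoD)
    then obtain r where r: "r > 0" "\<And>t. \<bar>t\<bar> < r \<Longrightarrow> c t \<in> U"
      unfolding eventually_nhds_metric by (auto simp: dist_real_def)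
    define t where "t = r / 2"
    have t: "t > 0" "\<bar>t\<bar> < r" "\<bar>- t\<bar> < r" using r by (auto simp: t_def)
    have "B (c t) w = 0" "B (c (- t)) w = 0" "B g w = 0"
      using zero null r t assms by blast+
    then have "t * B v w - t\<^sup>2 * q v / (2 * B g h) * B h w = 0" "- t * B v w - t\<^sup>2 * q v / (2 * B g h) * B h w = 0"
      by (auto simp: c_def expand)
    \<comment> \<open>The values at \<open>t\<close> and \<open>- t\<close> separate the odd from
      the even part.\<close>
    then have "t * B v w = 0" "t\<^sup>2 * q v / (2 * B g h) * B h w = 0" by argo+
    then show ?thesis using t h by auto
  qed
  obtain v where v: "B g v = 0" "B h v = 0" "q v = - 2 * B g h"
    using ex_perp[OF assms(1) h] by blast
  have hw: "B h w = 0" using perp[OF v(1,2)] v(3) h by auto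
  have gw: "B g w = 0" using zero assms by blast
  obtain x where x: "B w x \<noteq> 0" using nondegenerate assms by blast
  obtain \<alpha> \<beta> u where "x = \<alpha> *\<^sub>R g + \<beta> *\<^sub>R h + u" "B g u = 0" "B h u = 0"
    using perp_decomposition[of g h x] assms h by auto
  then have "B x w = 0" using perp[of u] hw gw by (simp add: expand)
  then show False using x sym by metis
qed

lemma open_nonorthogonal: "open {x. B x w \<noteq> 0}"
proof -
  have "open ((\<lambda>x. B x w) -` (- {0}))"
    by (intro open_vimage B.continuous_on continuous_intros; auto)
  then show ?thesis by (simp add: vimage_def)
qed

lemma ex_generic_null:
  assumes "w \<noteq> 0"
  obtains d where "q d = 0" "B d w \<noteq> 0"
  using ex_null ex_generic_null_near[of _ w UNIV] assms by (metis UNIV_I open_UNIV)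

lemma ex_generic_null2:
  assumes "w \<noteq> 0" "w' \<noteq> 0"
  obtains d where "q d = 0" "B d w \<noteq> 0" "B d w' \<noteq> 0"
proof -
  obtain d where d: "q d = 0" "B d w \<noteq> 0" using ex_generic_null assms by blast
  then have "d \<noteq> 0" by (auto simp: expand)
  then show thesis using ex_generic_null_near[of d w' "{x. B x w \<noteq> 0}"] d assms open_nonorthogonal that by auto
qed

lemma ex_generic_null3:
  assumes "w \<noteq> 0" "w' \<noteq> 0" "w'' \<noteq> 0"
  obtains d where "q d = 0" "B d w \<noteq> 0" "B d w' \<noteq> 0" "B d w'' \<noteq> 0"
proof -
  obtain d where d: "q d = 0" "B d w \<noteq> 0" "B d w' \<noteq> 0" using ex_generic_null2 assms by blast
  then have "d \<noteq> 0" by (auto simp: expand)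
  then show thesis
    using ex_generic_null_near[of d w'' "{x. B x w \<noteq> 0} \<inter> {x. B x w' \<noteq> 0}"] d assms open_nonorthogonal that
    by (auto simp: open_Int)
qed

lemma ex_nonorthogonal_near:
  assumes "open U" "c \<in> U" "w \<noteq> 0"
  obtains c' where "c' \<in> U" "B (c' - b) w \<noteq> 0"
proof (cases "B (c - b) w = 0")
  case False then show thesis using that assms by blast
next
  case True
  obtain v where v: "B w v \<noteq> 0" using nondegenerate assms by blast
  have "((\<lambda>t. c + t *\<^sub>R v) \<longlongrightarrow> c + 0 *\<^sub>R v) (at (0::real))" by (intro tendsto_intros)
  then have "\<forall>\<^sub>F t in at 0. c + t *\<^sub>R v \<in> U" using assms by (intro topological_tendstoD) auto
  moreover have "\<forall>\<^sub>F t::real in at 0. t \<noteq> 0" by (simp add: eventually_at_filter)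
  ultimately obtain t where t: "t \<noteq> 0" "c + t *\<^sub>R v \<in> U"
    by (metis (mono_tags, lifting) at_neq_bot eventually_conj eventually_happens)
  have "B (c + t *\<^sub>R v - b) w = B (c - b) w + t * B v w" by (simp add: expand)
  then show thesis using that[OF t(2)] t True v sym[of w v] by auto
qed

text \<open>From \<open>0\<close>, move along a generic light line \<open>\<real>d\<close> to its
  point coherent to \<open>x\<close>; the rest of the way is null.\<close>

lemma ex_null_sum: obtains d d' where "x = d + d'" "q d = 0" "q d' = 0"
proof (cases "x = 0")
  case True then show thesis using that[of 0 0] by simp
next
  case False
  then obtain d where d: "q d = 0" "B d x \<noteq> 0" using ex_generic_null by blast
  let ?d = "(q x / (2 * B x d)) *\<^sub>R d"
  have "q (x - ?d) = 0" using foot_coherent[of d x 0] d sym[of d x] by simp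
  then show thesis using that[of ?d "x - ?d"] d by (simp add: q_scale)
qed

text \<open>Along the null parabola \<open>e + t v - t^2 c f\<close>, the form \<open>q\<close> of
  the image is a polynomial in \<open>t\<close> that vanishes identically. Its coefficients show
  that \<open>u\<close> keeps \<open>v\<close> orthogonal to \<open>e\<close> and \<open>f\<close>
  and scales \<open>q v\<close> by \<open>l\<close>, the factor measured on the pair
  \<open>e\<close>, \<open>f\<close>.\<close>

lemma null_preserving_imp_similarity:
  assumes lin: "linear u" and null: "\<And>x. q x = 0 \<Longrightarrow> q (u x) = 0"
  shows "\<exists>l. \<forall>x. q (u x) = l * q x"
proof -
  interpret u: linear u by (rule lin)
  obtain e where e: "e \<noteq> 0" "q e = 0" using ex_null by blast
  obtain f where f: "q f = 0" "B e f > 0" using ex_null_partner e by blast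
  define l where "l = B (u e) (u f) / B e f"
  have ue: "q (u e) = 0" and uf: "q (u f) = 0" using null e f by auto
  have perp: "B (u e) (u v) = 0 \<and> B (u f) (u v) = 0 \<and> q (u v) = l * q v"
    if v: "B e v = 0" "B f v = 0" for v
  proof (cases "v = 0")
    case True then show ?thesis by (simp add: u.zero)
  next
    case False
    have "v \<noteq> k *\<^sub>R e" for k
      using v(2) f(2) False sym[of f e] by (auto simp: B.scaleR_right)
    then have qv: "q v < 0" using null_orthogonal[of e v] e v by blast
    define c where "c = q v / (2 * B e f)"
    have c: "2 * c * B (u e) (u f) = l * q v" using f by (simp add: c_def l_def field_simps)
    have "q (e + t *\<^sub>R v - (t\<^sup>2 * c) *\<^sub>R f) = 0" for t
      using v e f sym[of v e] sym[of v f] sym[of f e]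
      by (simp add: expand c_def power2_eq_square field_simps)
    then have "q (u e + t *\<^sub>R u v - (t\<^sup>2 * c) *\<^sub>R u f) = 0" for t
      using null[of "e + t *\<^sub>R v - (t\<^sup>2 * c) *\<^sub>R f"] by (simp add: u.add u.diff u.scale)
    moreover have "q (u e + t *\<^sub>R u v - (t\<^sup>2 * c) *\<^sub>R u f) =
      t * (2 * B (u e) (u v)) + t\<^sup>2 * (q (u v) - l * q v) - t ^ 3 * (2 * c * B (u f) (u v))" for t
      unfolding c[symmetric]
      using ue uf sym[of "u v" "u e"] sym[of "u v" "u f"] sym[of "u f" "u e"]
      by (simp add: expand power2_eq_square power3_eq_cube algebra_simps)
    ultimately have *: "t * (2 * B (u e) (u v)) + t\<^sup>2 * (q (u v) - l * q v) - t ^ 3 * (2 * c * B (u f) (u v)) = 0" for t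
      by metis
    have "p = 0 \<and> r = 0 \<and> s = 0" if "\<And>t. t * p + t\<^sup>2 * r - t ^ 3 * s = 0" for p r s :: real
    proof -
      have "p + r - s = 0" "- p + r + s = 0" "2 * p + 4 * r - 8 * s = 0"
        using that[of 1] that[of "- 1"] that[of 2] by simp_all
      then show ?thesis by linarith
    qed
    from this[OF *]
    have "B (u e) (u v) = 0 \<and> q (u v) = l * q v \<and> c * B (u f) (u v) = 0" by auto
    moreover have "c \<noteq> 0" using qv f by (simp add: c_def)
    ultimately show ?thesis by auto
  qed
  have "q (u x) = l * q x" for x
  proof -
    obtain \<alpha> \<beta> v where x: "x = \<alpha> *\<^sub>R e + \<beta> *\<^sub>R f + v" and v: "B e v = 0" "B f v = 0"
      using perp_decomposition[of e f x] e f by auto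
    have "q x = 2 * \<alpha> * \<beta> * B e f + q v"
      unfolding x using e f v sym[of v e] sym[of v f] sym[of f e] by (simp add: expand)
    moreover have "u x = \<alpha> *\<^sub>R u e + \<beta> *\<^sub>R u f + u v" unfolding x by (simp add: u.add u.scale)
    then have "q (u x) = 2 * \<alpha> * \<beta> * B (u e) (u f) + l * q v"
      using ue uf perp[OF v] sym[of "u v" "u e"] sym[of "u v" "u f"] sym[of "u f" "u e"]
      by (simp add: expand)
    ultimately show ?thesis using f(2) by (simp add: l_def field_simps)
  qed
  then show ?thesis by blast
qed

end

section \<open>From the coordinate definition to a bilinear form\<close>

lemma minkowski_form_imp_minkowski_space:
  fixes q :: "'v::euclidean_space \<Rightarrow> real"
  assumes dim: "DIM('v) \<ge> 3" and q: "minkowski_form q"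
  obtains B :: "'v \<Rightarrow> 'v \<Rightarrow> real" where "minkowski_space B" "\<And>x. q x = B x x"
proof -
  let ?n = "DIM('v)" and ?I = "{1..<DIM('v)}"
  obtain b :: "nat \<Rightarrow> 'v" where ind: "independent (b ` {..<?n})" and inj: "inj_on b {..<?n}"
    and span: "span (b ` {..<?n}) = UNIV"
    and form: "\<forall>c :: nat \<Rightarrow> real. q (\<Sum>i<?n. c i *\<^sub>R b i) = (c 0)\<^sup>2 - (\<Sum>i\<in>?I. (c i)\<^sup>2)"
    using q unfolding minkowski_form_def by (elim conjE exE) (rule that)
  define X where "X x i = representation (b ` {..<?n}) x (b i)" for x i
  have lin: "linear (\<lambda>x. X x i)" for i
    unfolding X_def using ind span
    by (intro linearI) (simp_all add: representation_add representation_scale)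
  have X_sum: "x = (\<Sum>i<?n. X x i *\<^sub>R b i)" for x
  proof -
    have "(\<Sum>v\<in>b ` {..<?n}. representation (b ` {..<?n}) x v *\<^sub>R v) = x"
      using ind span by (intro sum_representation_eq) auto
    then show ?thesis by (simp add: sum.reindex[OF inj] X_def)
  qed
  have X_b: "X (b j) i = (if i = j then 1 else 0)" if "i < ?n" "j < ?n" for i j
    using that ind inj by (auto simp: X_def representation_basis inj_on_eq_iff)
  define B where "B x y = X x 0 * X y 0 - (\<Sum>i\<in>?I. X x i * X y i)" for x y
  have qB: "q x = B x x" for x
    using form[rule_format, of "X x"] X_sum[of x] by (simp add: B_def power2_eq_square)
  have X_add: "X (x + y) i = X x i + X y i" and X_scale: "X (r *\<^sub>R x) i = r * X x i" for x y r i
    using linear_add[OF lin[of i], of x y] linear_scale[OF lin[of i], of r x] by simp_all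
  have "minkowski_space B"
  proof
    show "bilinear B" unfolding bilinear_def B_def
      by (intro allI conjI linearI)
        (simp_all add: X_add X_scale sum.distrib sum_distrib_left algebra_simps)
    show "B x y = B y x" for x y by (simp add: B_def mult.commute)
    show "\<exists>y. B x y \<noteq> 0" if "x \<noteq> 0" for x
    proof -
      have "\<exists>j<?n. X x j \<noteq> 0"
      proof (rule ccontr)
        assume "\<not> (\<exists>j<?n. X x j \<noteq> 0)"
        then have "(\<Sum>i<?n. X x i *\<^sub>R b i) = 0" by (intro sum.neutral) auto
        then show False using X_sum[of x] \<open>x \<noteq> 0\<close> by simp
      qed
      then obtain j where j: "j < ?n" "X x j \<noteq> 0" by blast
      have "B x (b j) = (if j = 0 then X x j else - X x j)"
      proof (cases "j = 0")
        case True
        then have "(\<Sum>i\<in>?I. X x i * X (b j) i) = 0" using j by (intro sum.neutral) (auto simp: X_b)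
        then show ?thesis using True j by (simp add: B_def X_b)
      next
        case False
        have "(\<Sum>i\<in>?I. X x i * X (b j) i) = (\<Sum>i\<in>?I. if i = j then X x i else 0)"
          using j by (intro sum.cong) (auto simp: X_b)
        then show ?thesis using False j by (simp add: B_def X_b)
      qed
      then show ?thesis using j by (intro exI[of _ "b j"]) auto
    qed
    show "B y y < 0 \<or> (\<exists>k. y = k *\<^sub>R x)" if x: "B x x = 0" "x \<noteq> 0" "B x y = 0" for x y
    proof -
      \<comment> \<open>For null \<open>x\<close> orthogonal to \<open>y\<close>, this sum of
        squares equals \<open>- (X x 0)\<^sup>2 * B y y\<close>; so either \<open>B y y < 0\<close>,
        or every square vanishes and \<open>y\<close> is proportional to \<open>x\<close>.\<close>
      let ?s = "\<Sum>i\<in>?I. (X x 0 * X y i - X y 0 * X x i)\<^sup>2"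
      have xx: "(\<Sum>i\<in>?I. X x i * X x i) = X x 0 * X x 0" and xy: "(\<Sum>i\<in>?I. X x i * X y i) = X x 0 * X y 0"
        using x by (simp_all add: B_def)
      have x0: "X x 0 \<noteq> 0"
      proof
        assume 0: "X x 0 = 0"
        then have "(\<Sum>i\<in>?I. X x i * X x i) = 0" using xx by simp
        then have "\<forall>i\<in>?I. X x i * X x i = 0" by (subst (asm) sum_nonneg_eq_0_iff) auto
        then have "X x i = 0" if "i < ?n" for i using 0 that by (cases "i = 0") auto
        then show False using X_sum[of x] x(2) by simp
      qed
      have "?s = (X x 0)\<^sup>2 * (\<Sum>i\<in>?I. X y i * X y i) - 2 * X x 0 * X y 0 * (\<Sum>i\<in>?I. X x i * X y i)
          + (X y 0)\<^sup>2 * (\<Sum>i\<in>?I. X x i * X x i)"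
        by (simp add: sum_distrib_left sum_subtractf[symmetric] sum.distrib[symmetric] power2_eq_square algebra_simps)
      also have "\<dots> = - (X x 0)\<^sup>2 * B y y"
        unfolding xx xy by (simp add: B_def power2_eq_square algebra_simps)
      finally have s: "?s = - (X x 0)\<^sup>2 * B y y" .
      show ?thesis
      proof (cases "B y y < 0")
        case False
        then have "?s \<le> 0" unfolding s by simp
        moreover have "?s \<ge> 0" by (intro sum_nonneg) simp
        ultimately have "?s = 0" by simp
        then have "\<forall>i\<in>?I. (X x 0 * X y i - X y 0 * X x i)\<^sup>2 = 0" by (subst (asm) sum_nonneg_eq_0_iff) auto
        then have eq: "X x 0 * X y i = X y 0 * X x i" if "i \<in> ?I" for i using that by simp
        define c where "c = X y 0 / X x 0"
        have c: "X y i = c * X x i" if "i < ?n" for i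
        proof (cases "i = 0")
          case False
          then have "X x 0 * X y i = X y 0 * X x i" using that by (intro eq) simp
          then show ?thesis using x0 by (simp add: c_def field_simps)
        qed (use x0 in \<open>simp add: c_def\<close>)
        have "y = (\<Sum>i<?n. X y i *\<^sub>R b i)" by (rule X_sum)
        also have "\<dots> = (\<Sum>i<?n. (c * X x i) *\<^sub>R b i)" by (intro sum.cong) (simp_all add: c)
        also have "\<dots> = c *\<^sub>R (\<Sum>i<?n. X x i *\<^sub>R b i)" by (simp add: scaleR_sum_right)
        also have "\<dots> = c *\<^sub>R x" by (simp only: X_sum[symmetric])
        finally show ?thesis by blast
      qed simp
    qed
    show "\<exists>x. x \<noteq> 0 \<and> B x x = 0"
    proof (intro exI conjI)
      let ?x = "b 0 + b 1"
      have X: "X ?x i = (if i = 0 \<or> i = 1 then 1 else 0)" if "i < ?n" for i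
        unfolding X_add using that dim by (auto simp: X_b)
      have "(\<Sum>i\<in>?I. X ?x i * X ?x i) = (\<Sum>i\<in>?I. if i = 1 then 1 else 0)"
      proof (rule sum.cong)
        show "X ?x i * X ?x i = (if i = 1 then 1 else 0)" if "i \<in> ?I" for i using X[of i] that by auto
      qed simp
      also have "\<dots> = 1" using dim by simp
      finally show "B ?x ?x = 0" using X[of 0] by (simp add: B_def)
      show "?x \<noteq> 0" using X[of 0] linear_0[OF lin] by auto
    qed
    show "DIM('v) \<ge> 3" by (rule dim)
  qed
  then show thesis using that qB by blast
qed

section \<open>Light lines under a nondegenerate preserver\<close>

text \<open>\<open>ex_noncoherent\<close> expresses nondegeneracy through the cones whose vertex is
  an image point.\<close>

locale nondegenerate_preserver = minkowski_space +
  fixes \<phi> :: "'a \<Rightarrow> 'a"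
  assumes cont: "continuous_on UNIV \<phi>"
    and coherent: "q (b - a) = 0 \<Longrightarrow> q (\<phi> b - \<phi> a) = 0"
    and ex_noncoherent: "\<exists>b. q (\<phi> b - \<phi> a) \<noteq> 0"
begin

definition noncoh :: "'a \<Rightarrow> 'a set" where
  "noncoh a = {c. q (\<phi> c - \<phi> a) \<noteq> 0}"

lemma open_noncoh: "open (noncoh a)"
proof -
  have "open ((\<lambda>c. q (\<phi> c - \<phi> a)) -` (- {0}))"
    by (intro open_vimage B.continuous_on continuous_intros cont; auto)
  then show ?thesis by (simp add: vimage_def noncoh_def)
qed

lemma noncoh_nonempty: obtains c where "c \<in> noncoh a"
  using ex_noncoherent unfolding noncoh_def by blast

lemma noncohD: "c \<in> noncoh a \<Longrightarrow> q (c - a) \<noteq> 0"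
  using coherent unfolding noncoh_def by blast

lemma coherent_ray: "q d = 0 \<Longrightarrow> q (\<phi> (a + s *\<^sub>R d) - \<phi> (a + t *\<^sub>R d)) = 0"
  by (intro coherent) (simp add: expand)

lemma tendsto_\<phi>: "(f \<longlongrightarrow> l) F \<Longrightarrow> ((\<lambda>x. \<phi> (f x)) \<longlongrightarrow> \<phi> l) F"
  using continuous_on_tendsto_compose[OF cont, of f l F] by simp

text \<open>The point of the line coherent to some \<open>c \<in> noncoh a\<close> has an image
  coherent to \<open>\<phi> c\<close>, which \<open>\<phi> a\<close> is not.\<close>

lemma nonconstant_on_light_line:
  assumes "q d = 0" "d \<noteq> 0"
  obtains t where "\<phi> (a + t *\<^sub>R d) \<noteq> \<phi> a"
proof -
  obtain c0 where "c0 \<in> noncoh a" using noncoh_nonempty by blast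
  then obtain c where c: "c \<in> noncoh a" "B (c - a) d \<noteq> 0"
    using ex_nonorthogonal_near[OF open_noncoh] assms by blast
  let ?t = "q (c - a) / (2 * B (c - a) d)"
  have "q (\<phi> c - \<phi> (a + ?t *\<^sub>R d)) = 0" using foot_coherent c assms by (intro coherent)
  then have "\<phi> (a + ?t *\<^sub>R d) \<noteq> \<phi> a" using c unfolding noncoh_def by auto
  then show thesis using that by blast
qed

text \<open>The direction of the light line containing the image of \<open>b + \<real>e\<close>,
  written as a span so that no generator has to be chosen; it is one-dimensional for null nonzero
  \<open>e\<close>.\<close>

definition image_dir :: "'a \<Rightarrow> 'a \<Rightarrow> 'a set" where
  "image_dir b e = span (range (\<lambda>s. \<phi> (b + s *\<^sub>R e) - \<phi> b))"

lemma image_dirI: "\<phi> (b + s *\<^sub>R e) - \<phi> b \<in> image_dir b e"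
  unfolding image_dir_def by (intro span_base) auto

lemma image_dirI1: "\<phi> y - \<phi> b \<in> image_dir b (y - b)"
  using image_dirI[of b 1 "y - b"] by simp

text \<open>The images of points of a light line are pairwise coherent, so by
  \<open>null_triangle\<close> their differences are multiples of any nonzero one.\<close>

lemma image_dir_eq_span:
  assumes "q e = 0" "z \<in> image_dir b e" "z \<noteq> 0"
  shows "image_dir b e = span {z}"
proof -
  obtain s where s: "\<phi> (b + s *\<^sub>R e) - \<phi> b \<noteq> 0"
  proof (rule ccontr)
    note ex = that
    assume "\<not> thesis"
    then have "range (\<lambda>s. \<phi> (b + s *\<^sub>R e) - \<phi> b) \<subseteq> {0}" using ex by blast
    then have "image_dir b e \<subseteq> span {0}" unfolding image_dir_def by (rule span_mono)
    then show False using assms by auto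
  qed
  define m where "m = \<phi> (b + s *\<^sub>R e) - \<phi> b"
  have "\<phi> (b + t *\<^sub>R e) - \<phi> b \<in> span {m}" for t
  proof -
    have "q (m - (\<phi> (b + t *\<^sub>R e) - \<phi> b)) = 0" using coherent_ray[OF assms(1), of b s t] unfolding m_def by simp
    moreover have "q m = 0" "q (\<phi> (b + t *\<^sub>R e) - \<phi> b) = 0"
      using coherent_ray[OF assms(1), of b s 0] coherent_ray[OF assms(1), of b t 0] unfolding m_def by simp_all
    ultimately have "\<exists>k. \<phi> (b + t *\<^sub>R e) - \<phi> b = k *\<^sub>R m" using null_triangle s m_def by blast
    then show ?thesis by (auto simp: span_singleton)
  qed
  then have "image_dir b e \<subseteq> span {m}" unfolding image_dir_def
    by (intro span_minimal) (auto simp: subspace_span)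
  moreover have "m \<in> image_dir b e" unfolding m_def by (rule image_dirI)
  ultimately have eq: "image_dir b e = span {m}"
    by (metis image_dir_def span_minimal subspace_span empty_subsetI insert_subset subset_antisym)
  then obtain k where k: "z = k *\<^sub>R m" using assms by (auto simp: span_singleton)
  then have "m = inverse k *\<^sub>R z" using assms by auto
  then have "span {m} \<subseteq> span {z}" by (auto simp: span_singleton)
  moreover have "span {z} \<subseteq> span {m}" using k by (auto simp: span_singleton)
  ultimately show ?thesis using eq by simp
qed

lemma image_dir_eq:
  assumes "q e = 0" "q f = 0" "z \<in> image_dir b e" "z \<in> image_dir b f" "z \<noteq> 0"
  shows "image_dir b e = image_dir b f"
  using image_dir_eq_span assms by metis

lemma image_dir_generator:
  assumes "q e = 0" "e \<noteq> 0"
  obtains m where "m \<noteq> 0" "q m = 0" "image_dir b e = span {m}"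
proof -
  obtain t where t: "\<phi> (b + t *\<^sub>R e) - \<phi> b \<noteq> 0" using nonconstant_on_light_line assms by (metis right_minus_eq)
  then have "image_dir b e = span {\<phi> (b + t *\<^sub>R e) - \<phi> b}"
    using image_dir_eq_span assms image_dirI by blast
  moreover have "q (\<phi> (b + t *\<^sub>R e) - \<phi> b) = 0" using coherent_ray[OF assms(1), of b t 0] by simp
  ultimately show thesis using that t by blast
qed

lemma image_dir_scale: "k \<noteq> 0 \<Longrightarrow> image_dir b (k *\<^sub>R e) = image_dir b e"
proof -
  assume k: "k \<noteq> 0"
  have "range (\<lambda>s. \<phi> (b + s *\<^sub>R k *\<^sub>R e) - \<phi> b) = (\<lambda>s. \<phi> (b + s *\<^sub>R e) - \<phi> b) ` range (\<lambda>s. s * k)"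
    by (auto simp: image_image)
  also have "range (\<lambda>s. s * k) = UNIV" using k by (intro surjI[of _ "\<lambda>s. s / k"]) simp
  finally show ?thesis by (simp add: image_dir_def)
qed

text \<open>
  Pick \<open>c\<close> with \<open>\<phi> c\<close> not coherent to \<open>\<phi> b\<close>, let \<open>y\<close> be the point of \<open>b + \<real>f0\<close> coherent to \<open>c\<close>,
  and \<open>x\<close> the point of the line \<open>cy\<close> coherent to \<open>a\<close>. Then \<open>\<phi> x = \<phi> y\<close>, and \<open>\<phi>\<close> maps every
  point coherent to both \<open>b\<close> and \<open>x\<close> into the line through \<open>\<phi> b\<close> and \<open>\<phi> y\<close>.
\<close>

lemma image_dir_locally_constant:
  assumes "q (a - b) = 0" "\<phi> a = \<phi> b" "q f0 = 0" "B (a - b) f0 \<noteq> 0"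
  shows "\<forall>\<^sub>F f in nhds f0. q f = 0 \<longrightarrow> image_dir b f = image_dir b f0"
proof -
  have f0: "f0 \<noteq> 0" using assms(4) by (auto simp: expand)
  obtain c0 where "c0 \<in> noncoh b" using noncoh_nonempty by blast
  then obtain c where c: "c \<in> noncoh b" "B (c - b) f0 \<noteq> 0"
    using ex_nonorthogonal_near[OF open_noncoh] f0 by blast
  define s where "s = q (c - b) / (2 * B (c - b) f0)"
  define y where "y = b + s *\<^sub>R f0"
  have s: "s \<noteq> 0" unfolding s_def using c noncohD[of c b] by auto
  have cy: "q (c - y) = 0" unfolding y_def s_def using foot_coherent assms c by blast
  have yb: "q (y - b) = 0" unfolding y_def using assms by (simp add: expand)
  have "c \<noteq> y" using yb c noncohD by blast
  have qay: "q (a - y) \<noteq> 0"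
  proof -
    have "q (a - y) = q (a - b - s *\<^sub>R f0)" by (simp add: y_def diff_diff_eq)
    also have "\<dots> = - 2 * s * B (a - b) f0"
      unfolding q_diff[of "a - b"] using assms(1,3) by (simp add: B.scaleR_left B.scaleR_right)
    finally show ?thesis using s assms by simp
  qed
  then have "a - y \<noteq> 0" by (auto simp: expand)
  moreover have "open ((\<lambda>g. y + g) -` noncoh b)"
    by (intro open_vimage open_noncoh continuous_intros)
  \<comment> \<open>Replacing \<open>c\<close> by \<open>y + g\<close> tilts the light line through
    \<open>y\<close> so that it meets the cone of \<open>a\<close>, while \<open>y + g\<close> stays
    in \<open>noncoh b\<close>.\<close>
  ultimately obtain g where g: "y + g \<in> noncoh b" "q g = 0" "B g (a - y) \<noteq> 0"
    using ex_generic_null_near[of "c - y" "a - y" "(\<lambda>g. y + g) -` noncoh b"] cy \<open>c \<noteq> y\<close> c by auto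
  have gf0: "B g f0 \<noteq> 0"
  proof
    assume "B g f0 = 0"
    then have "q (g + s *\<^sub>R f0) = 0"
      using g assms(3) by (simp add: q_add B.scaleR_left B.scaleR_right)
    moreover have "g + s *\<^sub>R f0 = y + g - b" by (simp add: y_def)
    ultimately have "q (y + g - b) = 0" by metis
    then show False using noncohD g by blast
  qed
  define r where "r = q (a - y) / (2 * B (a - y) g)"
  have r: "r \<noteq> 0" unfolding r_def using qay g(3) sym[of g "a - y"] by simp
  define x where "x = y + r *\<^sub>R g"
  have ax: "q (a - x) = 0" unfolding x_def r_def using foot_coherent[of g a y] g sym[of g "a - y"] by auto
  have \<phi>gy: "q (\<phi> (y + g) - \<phi> y) = 0" using g by (intro coherent) simp
  have \<phi>yb: "q (\<phi> y - \<phi> b) = 0" using coherent yb by blast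
  have \<phi>gb: "q (\<phi> (y + g) - \<phi> b) \<noteq> 0" using g by (simp add: noncoh_def)
  have yneb: "\<phi> y \<noteq> \<phi> b" using \<phi>gy \<phi>gb by auto
  \<comment> \<open>\<open>\<phi> x\<close> is coherent to \<open>\<phi> a = \<phi> b\<close> and
    lies on the light line through \<open>\<phi> y\<close> and \<open>\<phi> (y + g)\<close>, where
    only \<open>\<phi> y\<close> is coherent to \<open>\<phi> b\<close>.\<close>
  have xy: "\<phi> x = \<phi> y"
  proof -
    let ?u = "\<phi> (y + g) - \<phi> y" and ?w = "\<phi> y - \<phi> b"
    have u0: "?u \<noteq> 0" using \<phi>yb \<phi>gb by auto
    have "q (?u - (\<phi> x - \<phi> y)) = 0" "q (\<phi> x - \<phi> y) = 0"
      using coherent_ray[OF g(2), of y 1 r] coherent_ray[OF g(2), of y r 0] unfolding x_def by simp_all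
    then obtain k where k: "\<phi> x - \<phi> y = k *\<^sub>R ?u" using null_triangle[of ?u] \<phi>gy u0 by blast
    have w1: "q (?w + 1 *\<^sub>R ?u) \<noteq> 0" using \<phi>gb by simp
    have wk: "q (?w + k *\<^sub>R ?u) = 0"
      unfolding k[symmetric] using coherent[OF ax] assms(2) q_minus_commute[of "\<phi> x" "\<phi> b"] by simp
    have "q (?w + j *\<^sub>R ?u) = 2 * j * B ?w ?u" for j
      unfolding q_add[of ?w] using \<phi>gy \<phi>yb by (simp add: B.scaleR_left B.scaleR_right)
    then have "k = 0" using w1 wk by (metis mult_eq_0_iff mult_zero_right)
    then show ?thesis using k by simp
  qed
  have xb: "x - b = s *\<^sub>R f0 + r *\<^sub>R g" by (simp add: x_def y_def)
  have Bx: "B (x - b) f0 = r * B g f0" unfolding xb using assms(3) by (simp add: expand)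
  have qx: "q (x - b) = 2 * s * r * B g f0" unfolding xb using assms(3) g sym[of f0 g] by (simp add: expand)
  \<comment> \<open>\<open>b + \<tau> f *\<^sub>R f\<close> is the point in direction
    \<open>f\<close> coherent to \<open>x\<close>. It is continuous in \<open>f\<close> near
    \<open>f0\<close> and equals \<open>y\<close> at \<open>f0\<close>, so its image stays different
    from \<open>\<phi> b\<close> nearby.\<close>
  define \<tau> where "\<tau> f = q (x - b) / (2 * B (x - b) f)" for f
  have \<tau>0: "\<tau> f0 = s" unfolding \<tau>_def Bx qx using r gf0 by simp
  have lim: "((\<lambda>f. B (x - b) f) \<longlongrightarrow> B (x - b) f0) (nhds f0)" by (intro B.tendsto tendsto_const filterlim_ident)
  have Bx0: "B (x - b) f0 \<noteq> 0" unfolding Bx using r gf0 by simp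
  have "(\<tau> \<longlongrightarrow> \<tau> f0) (nhds f0)" unfolding \<tau>_def using lim Bx0 by (intro tendsto_intros) auto
  then have "((\<lambda>f. \<phi> (b + \<tau> f *\<^sub>R f)) \<longlongrightarrow> \<phi> (b + \<tau> f0 *\<^sub>R f0)) (nhds f0)"
    by (intro tendsto_\<phi> tendsto_intros filterlim_ident)
  then have "\<forall>\<^sub>F f in nhds f0. \<phi> (b + \<tau> f *\<^sub>R f) \<noteq> \<phi> b"
    using yneb unfolding \<tau>0 y_def[symmetric] by (rule tendsto_imp_eventually_ne)
  moreover have "\<forall>\<^sub>F f in nhds f0. B (x - b) f \<noteq> 0" using lim Bx0 by (rule tendsto_imp_eventually_ne)
  ultimately show ?thesis
  proof eventually_elim
    case (elim f)
    show ?case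
    proof
      assume f: "q f = 0"
      let ?y = "b + \<tau> f *\<^sub>R f"
      have "q (x - ?y) = 0" unfolding \<tau>_def using foot_coherent f elim by blast
      then have 1: "q ((\<phi> x - \<phi> b) - (\<phi> ?y - \<phi> b)) = 0" using coherent by simp
      have 2: "q (\<phi> x - \<phi> b) = 0" "q (\<phi> ?y - \<phi> b) = 0"
        using xy \<phi>yb coherent_ray[OF f, of b "\<tau> f" 0] by simp_all
      obtain k where "\<phi> ?y - \<phi> b = k *\<^sub>R (\<phi> x - \<phi> b)"
        using null_triangle[OF 2 1] xy yneb by auto
      then have "\<phi> ?y - \<phi> b \<in> image_dir b f0"
        using image_dirI[of b s f0] unfolding xy y_def by (simp add: image_dir_def span_scale)
      then show "image_dir b f = image_dir b f0"
        using image_dir_eq[OF f assms(3)] image_dirI[of b "\<tau> f" f] elim by auto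
    qed
  qed
qed

text \<open>A null direction not orthogonal to \<open>a - b\<close> is joined to a multiple of
  \<open>a - b\<close> by a conic in the null cone; \<open>image_dir_locally_constant\<close>
  applies along it up to the endpoint.\<close>

lemma image_dir_constant:
  assumes ab: "q (a - b) = 0" "a \<noteq> b" "\<phi> a = \<phi> b" and e: "q e = 0" "e \<noteq> 0"
  shows "image_dir b e = image_dir b (a - b)"
proof (cases "B (a - b) e = 0")
  case True
  then obtain k where "e = k *\<^sub>R (a - b)" using null_parallel[of "a - b" e] ab e by auto
  then show ?thesis using image_dir_scale[of k b "a - b"] e by auto
next
  case False
  define \<sigma> where "\<sigma> = sgn (B (a - b) e)"
  have \<sigma>: "\<sigma> \<noteq> 0" "\<sigma> * B (a - b) e > 0" using False by (auto simp: \<sigma>_def sgn_if)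
  define f where "f = \<sigma> *\<^sub>R (a - b)"
  have f: "q f = 0" "B e f > 0" using ab \<sigma> sym[of e "a - b"] by (simp_all add: f_def B.scaleR_left B.scaleR_right)
  obtain v where v: "B e v = 0" "B f v = 0" "q v = - 2 * B e f" using ex_perp[OF e(1) f] by blast
  define p where "p t = (1 - t)\<^sup>2 *\<^sub>R e + (t * (1 - t)) *\<^sub>R v + t\<^sup>2 *\<^sub>R f" for t :: real
  have p_null: "q (p t) = 0" for t
    unfolding p_def using e f v sym[of v e] sym[of v f] sym[of f e]
    by (simp add: expand) (simp add: power2_eq_square algebra_simps)
  have p_tendsto: "(p \<longlongrightarrow> p t) F" if "filterlim (\<lambda>t. t) (nhds t) F" for t F
    unfolding p_def using that by (intro tendsto_intros)
  have Bp: "\<sigma> * B (a - b) (p t) = (1 - t)\<^sup>2 * B e f" for t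
  proof -
    have "\<sigma> * B (a - b) (p t) = B f (p t)" by (simp add: f_def B.scaleR_left)
    also have "\<dots> = (1 - t)\<^sup>2 * B e f" unfolding p_def using f v sym[of f e] by (simp add: expand)
    finally show ?thesis .
  qed
  have const: "image_dir b (p t) = image_dir b e" if t: "t \<in> {0..<1}" for t
  proof -
    have "image_dir b (p 0) = image_dir b (p t)"
    proof (rule connected_local_const[where A = "{0..<1}"])
      show "\<forall>t\<in>{0..<1}. \<forall>\<^sub>F u in at t within {0..<1}. image_dir b (p t) = image_dir b (p u)"
      proof
        fix t :: real assume "t \<in> {0..<1}"
        then have "B (a - b) (p t) \<noteq> 0" using Bp[of t] f by auto
        then have "\<forall>\<^sub>F f in nhds (p t). q f = 0 \<longrightarrow> image_dir b f = image_dir b (p t)"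
          using image_dir_locally_constant ab p_null by blast
        moreover have "filterlim p (nhds (p t)) (at t within {0..<1})" by (intro p_tendsto tendsto_intros)
        ultimately have "\<forall>\<^sub>F u in at t within {0..<1}. q (p u) = 0 \<longrightarrow> image_dir b (p u) = image_dir b (p t)"
          by (rule eventually_compose_filterlim)
        then show "\<forall>\<^sub>F u in at t within {0..<1}. image_dir b (p t) = image_dir b (p u)"
          using p_null by (auto elim: eventually_mono)
      qed
    qed (use t in auto)
    then show ?thesis by (simp add: p_def)
  qed
  obtain s where s: "\<phi> (b + s *\<^sub>R f) \<noteq> \<phi> b" using nonconstant_on_light_line[of f b] f by (metis B.zero_right less_irrefl)
  define T where "T k = 1 - inverse (real (Suc k))" for k
  have "T \<longlonglongrightarrow> 1 - 0" unfolding T_def by (intro tendsto_intros LIMSEQ_inverse_real_of_nat)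
  then have "(\<lambda>k. p (T k)) \<longlonglongrightarrow> p 1"
    using filterlim_compose[OF p_tendsto[OF filterlim_ident]] by simp
  then have lim: "(\<lambda>k. \<phi> (b + s *\<^sub>R p (T k)) - \<phi> b) \<longlonglongrightarrow> \<phi> (b + s *\<^sub>R p 1) - \<phi> b"
    by (intro tendsto_intros tendsto_\<phi>)
  have "T k \<in> {0..<1}" for k unfolding T_def by (auto simp: field_simps)
  then have mem: "\<phi> (b + s *\<^sub>R p (T k)) - \<phi> b \<in> image_dir b e" for k
    using image_dirI const by metis
  have "closed (image_dir b e)" by (simp add: image_dir_def closed_subspace)
  then have "\<phi> (b + s *\<^sub>R p 1) - \<phi> b \<in> image_dir b e"
    by (rule closed_sequentially[OF _ mem lim])
  moreover have "p 1 = f" by (simp add: p_def)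
  ultimately have "image_dir b e = image_dir b f"
    using image_dir_eq[OF e(1) f(1)] image_dirI[of b s f] s by auto
  then show ?thesis using image_dir_scale \<sigma> f_def by simp
qed

section \<open>Injectivity\<close>

text \<open>Each such image is \<open>\<phi> b + k m\<close>, and coherence to
  \<open>\<phi> c\<close> forces \<open>q ?X = 2 k B ?X m\<close> with
  \<open>q ?X \<noteq> 0\<close>, which determines \<open>k\<close>.\<close>

lemma constant_on_cone_intersection:
  assumes dir: "\<And>e. q e = 0 \<Longrightarrow> e \<noteq> 0 \<Longrightarrow> image_dir b e = span {m}"
    and c: "c \<in> noncoh b"
    and y: "q (y - b) = 0" "q (c - y) = 0" and y': "q (y' - b) = 0" "q (c - y') = 0"
  shows "\<phi> y = \<phi> y'"
proof -
  let ?X = "\<phi> c - \<phi> b"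
  have *: "\<exists>k. \<phi> y = \<phi> b + k *\<^sub>R m \<and> q ?X = 2 * k * B ?X m" if y: "q (y - b) = 0" "q (c - y) = 0" for y
  proof -
    have "y \<noteq> b" using noncohD[OF c] y by auto
    then have "\<phi> y - \<phi> b \<in> span {m}" using dir[of "y - b"] image_dirI1[of y b] y by simp
    then obtain k where k: "\<phi> y - \<phi> b = k *\<^sub>R m" by (auto simp: span_singleton)
    have "q (k *\<^sub>R m) = 0" using coherent[OF y(1)] k by simp
    moreover have "q (?X - k *\<^sub>R m) = 0" using coherent[OF y(2)] unfolding k[symmetric] by simp
    ultimately have "q ?X = 2 * k * B ?X m" unfolding q_diff[of ?X] B.scaleR_right[of ?X] by simp
    then show ?thesis using k by (metis add.commute diff_add_cancel)
  qed
  have X: "q ?X \<noteq> 0" using c by (simp add: noncoh_def)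
  obtain k k' where "\<phi> y = \<phi> b + k *\<^sub>R m" "q ?X = 2 * k * B ?X m"
    "\<phi> y' = \<phi> b + k' *\<^sub>R m" "q ?X = 2 * k' * B ?X m"
    using *[OF y] *[OF y'] by blast
  moreover have "k = k'" using calculation(2,4) X by auto
  ultimately show ?thesis by simp
qed

text \<open>
  If \<open>\<phi> a = \<phi> b\<close>, the whole cone of \<open>b\<close> is mapped into one light line, so \<open>\<phi>\<close> is constant on its
  intersection with the cone of any \<open>c \<in> noncoh b\<close>. Moving \<open>c\<close> to \<open>C \<delta>\<close> yields \<open>y2 \<noteq> y\<close> on a light line
  through \<open>b\<close> with \<open>\<phi> y2 = \<phi> y\<close>, hence the cone of \<open>y\<close>, which contains \<open>b\<close> and \<open>c\<close>, also collapses
  to a line.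
\<close>

lemma inj_on_light_lines:
  assumes ab: "q (a - b) = 0" "\<phi> a = \<phi> b"
  shows "a = b"
proof (rule ccontr)
  assume ne: "a \<noteq> b"
  obtain m where m: "image_dir b (a - b) = span {m}" using image_dir_generator[of "a - b" b] ab ne by auto
  have dir: "image_dir b e = span {m}" if "q e = 0" "e \<noteq> 0" for e
    using image_dir_constant[OF ab(1) ne ab(2) that] m by simp
  obtain c where c: "c \<in> noncoh b" using noncoh_nonempty by blast
  note qcb = noncohD[OF c]
  have cb0: "c - b \<noteq> 0" using qcb by auto
  obtain d where d: "q d = 0" "B d (c - b) \<noteq> 0" using ex_generic_null cb0 by blast
  then have d0: "d \<noteq> 0" by auto
  \<comment> \<open>As \<open>d1\<close> is not orthogonal to \<open>d\<close>, the points
    \<open>y\<close> and \<open>y1\<close> common to the cones of \<open>b\<close> and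
    \<open>c\<close> will be noncoherent.\<close>
  obtain d1 where d1: "q d1 = 0" "B d1 (c - b) \<noteq> 0" "B d1 d \<noteq> 0"
    using ex_generic_null2 cb0 d0 by blast
  have dc: "B (c - b) d \<noteq> 0" "B (c - b) d1 \<noteq> 0" using d d1 sym by metis+
  define s where "s = q (c - b) / (2 * B (c - b) d)"
  define s1 where "s1 = q (c - b) / (2 * B (c - b) d1)"
  have ss1: "s \<noteq> 0" "s1 \<noteq> 0" using qcb dc by (auto simp: s_def s1_def)
  define y where "y = b + s *\<^sub>R d"
  define y1 where "y1 = b + s1 *\<^sub>R d1"
  have cy: "q (c - y) = 0" unfolding y_def s_def using foot_coherent dc d by blast
  have cy1: "q (c - y1) = 0" unfolding y1_def s1_def using foot_coherent dc d1 by blast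
  have yb: "q (y - b) = 0" "q (y1 - b) = 0" unfolding y_def y1_def using d d1 by (auto simp: q_scale)
  have y1y: "q (y1 - y) \<noteq> 0"
  proof -
    have "q (s1 *\<^sub>R d1 - s *\<^sub>R d) = - 2 * (s1 * s * B d1 d)"
      unfolding q_diff q_scale using d d1 by (simp add: B.scaleR_left B.scaleR_right)
    then show ?thesis using ss1 d1 by (simp add: y_def y1_def)
  qed
  \<comment> \<open>\<open>c\<close> moves along the light line through \<open>y1\<close>: coherence
    to \<open>y1\<close> persists, coherence to \<open>y\<close> is lost for
    \<open>\<delta> \<noteq> 0\<close>.\<close>
  define C where "C \<delta> = y1 + (1 + \<delta>) *\<^sub>R (c - y1)" for \<delta> :: real
  have "(C \<longlongrightarrow> C 0) (at 0)" unfolding C_def by (intro tendsto_intros)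
  then have C0: "(C \<longlongrightarrow> c) (at 0)" by (simp add: C_def)
  then have "\<forall>\<^sub>F \<delta> in at 0. C \<delta> \<in> noncoh b" by (rule topological_tendstoD[OF _ open_noncoh c])
  moreover have "((\<lambda>\<delta>. B (C \<delta> - b) d) \<longlongrightarrow> B (c - b) d) (at 0)"
    by (intro B.tendsto tendsto_intros C0)
  then have "\<forall>\<^sub>F \<delta> in at 0. B (C \<delta> - b) d \<noteq> 0" using dc(1) by (rule tendsto_imp_eventually_ne)
  moreover have "\<forall>\<^sub>F \<delta>::real in at 0. \<delta> \<noteq> 0" by (simp add: eventually_at_filter)
  ultimately have "\<forall>\<^sub>F \<delta> in at 0. C \<delta> \<in> noncoh b \<and> B (C \<delta> - b) d \<noteq> 0 \<and> \<delta> \<noteq> 0"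
    by eventually_elim auto
  then obtain \<delta> where \<delta>: "C \<delta> \<in> noncoh b" "B (C \<delta> - b) d \<noteq> 0" "\<delta> \<noteq> 0"
    using eventually_happens'[OF at_neq_bot] by blast
  define y2 where "y2 = b + (q (C \<delta> - b) / (2 * B (C \<delta> - b) d)) *\<^sub>R d"
  have Cy2: "q (C \<delta> - y2) = 0" unfolding y2_def using foot_coherent d \<delta> by blast
  have Cy1: "q (C \<delta> - y1) = 0" unfolding C_def using cy1 by (simp add: q_scale)
  have Cy: "q (C \<delta> - y) \<noteq> 0"
  proof -
    let ?u = "y1 - y" and ?w = "c - y1"
    have line: "q (?u + t *\<^sub>R ?w) = q ?u + t * (2 * B ?u ?w)" for t
      unfolding q_add[of ?u] q_scale using cy1 by (simp only: B.scaleR_right) simp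
    have "2 * B ?u ?w = - q ?u" using line[of 1] cy by simp
    then have "q (?u + (1 + \<delta>) *\<^sub>R ?w) = - \<delta> * q ?u"
      unfolding line by (simp add: distrib_right)
    moreover have "C \<delta> - y = ?u + (1 + \<delta>) *\<^sub>R ?w" by (simp add: C_def)
    ultimately have "q (C \<delta> - y) = - \<delta> * q ?u" by metis
    then show ?thesis using y1y \<delta>(3) by simp
  qed
  have y2b: "q (y2 - b) = 0" unfolding y2_def using d by (simp add: q_scale)
  \<comment> \<open>The cone intersections for \<open>c\<close> and for \<open>C \<delta>\<close>
    share \<open>y1\<close>, which links \<open>y\<close> to \<open>y2\<close>.\<close>
  have "\<phi> y = \<phi> y1" using constant_on_cone_intersection[OF dir c] yb cy cy1 by blast
  moreover have "\<phi> y1 = \<phi> y2" using constant_on_cone_intersection[OF dir \<delta>(1)] yb y2b Cy1 Cy2 by blast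
  ultimately have eq: "\<phi> y2 = \<phi> y" by simp
  have ne2: "y2 \<noteq> y" using Cy Cy2 by auto
  have y2y: "q (y2 - y) = 0" unfolding y2_def y_def using d by (simp add: expand)
  obtain m' where m': "q m' = 0" "image_dir y (y2 - y) = span {m'}"
    using image_dir_generator[of "y2 - y" y] y2y ne2 by auto
  have dir': "\<exists>k. \<phi> x = \<phi> y + k *\<^sub>R m'" if "q (x - y) = 0" "x \<noteq> y" for x
  proof -
    have "\<phi> x - \<phi> y \<in> span {m'}"
      using image_dir_constant[OF y2y ne2 eq, of "x - y"] image_dirI1[of x y] m' that by simp
    then obtain k where "\<phi> x - \<phi> y = k *\<^sub>R m'" by (auto simp: span_singleton)
    then show ?thesis by (metis add.commute diff_add_cancel)
  qed
  have "c \<noteq> y" "b \<noteq> y" using qcb yb cy q_minus_commute[of y b] ss1 d0 y_def by auto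
  then obtain k k' where "\<phi> c = \<phi> y + k *\<^sub>R m'" "\<phi> b = \<phi> y + k' *\<^sub>R m'"
    using dir'[of c] dir'[of b] cy yb q_minus_commute[of y b] by auto
  then have "\<phi> c - \<phi> b = (k - k') *\<^sub>R m'" by (simp add: algebra_simps)
  then have "q (\<phi> c - \<phi> b) = 0" using m' by (simp add: q_scale)
  then show False using c by (simp add: noncoh_def)
qed

text \<open>If \<open>\<phi> a = \<phi> b\<close>, then on a light line through some
  \<open>c \<in> noncoh a\<close> the points coherent to \<open>a\<close> and to \<open>b\<close>
  have images coherent to \<open>\<phi> a\<close> on one light line. These images coincide, hence so
  do the points; a generic direction prevents this.\<close>

lemma inj: "inj \<phi>"
proof (rule injI, rule ccontr)
  fix a b assume eq: "\<phi> a = \<phi> b" and ne: "a \<noteq> b"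
  have qab: "q (b - a) \<noteq> 0" using inj_on_light_lines[of b a] eq ne by auto
  obtain k where k: "k \<notin> span {b - a, b - a}" using ex_not_in_span by blast
  \<comment> \<open>Choosing \<open>c\<close> with \<open>B (c - a) z \<noteq> 0\<close> keeps it
    off the line through \<open>a\<close> and \<open>b\<close>, which makes \<open>w\<close>
    nonzero.\<close>
  define z where "z = k - (B k (b - a) / q (b - a)) *\<^sub>R (b - a)"
  have "z \<noteq> 0"
  proof
    assume "z = 0"
    then have "k = (B k (b - a) / q (b - a)) *\<^sub>R (b - a)" by (simp add: z_def)
    also have "\<dots> \<in> span {b - a, b - a}" by (intro span_scale span_base) simp
    finally show False using k by simp
  qed
  have zba: "B (b - a) z = 0"
    unfolding z_def using qab sym[of k "b - a"] by (simp add: B.diff_right[of _ k] B.scaleR_right)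
  obtain c0 where "c0 \<in> noncoh a" using noncoh_nonempty by blast
  then obtain c where c: "c \<in> noncoh a" "B (c - a) z \<noteq> 0"
    using ex_nonorthogonal_near[OF open_noncoh] \<open>z \<noteq> 0\<close> by blast
  have cb: "c \<in> noncoh b" using c eq by (simp add: noncoh_def)
  let ?p = "a - c" and ?r = "b - c"
  have qp: "q ?p \<noteq> 0" and qr: "q ?r \<noteq> 0"
    using noncohD[OF c(1)] noncohD[OF cb] q_minus_commute by metis+
  \<comment> \<open>\<open>B w d = 0\<close> says that the parameters \<open>t\<close> and
    \<open>t'\<close> agree, with denominators cleared.\<close>
  define w where "w = q ?p *\<^sub>R ?r - q ?r *\<^sub>R ?p"
  have "w \<noteq> 0"
  proof
    assume "w = 0"
    have pz: "B ?p z \<noteq> 0" using c(2) B.minus_left[of "c - a" z] by simp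
    have rz: "B ?r z = B ?p z" using zba by (simp add: B.diff_left)
    have "0 = B w z" using \<open>w = 0\<close> by simp
    also have "\<dots> = (q ?p - q ?r) * B ?p z"
      unfolding w_def B.diff_left[of "q ?p *\<^sub>R ?r"] B.scaleR_left rz by (simp add: algebra_simps)
    finally have "q ?p = q ?r" using pz by simp
    then have "q ?p *\<^sub>R (b - a) = 0" using \<open>w = 0\<close> unfolding w_def by (simp flip: scaleR_diff_right)
    then show False using qp ne by simp
  qed
  moreover have "?p \<noteq> 0" "?r \<noteq> 0" using qp qr by auto
  ultimately obtain d where "q d = 0" "B d w \<noteq> 0" "B d ?p \<noteq> 0" "B d ?r \<noteq> 0"
    using ex_generic_null3 by blast
  then have d: "q d = 0" "B w d \<noteq> 0" "B ?p d \<noteq> 0" "B ?r d \<noteq> 0" using sym by metis+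
  define t where "t = q ?p / (2 * B ?p d)"
  define t' where "t' = q ?r / (2 * B ?r d)"
  have ax: "q (a - (c + t *\<^sub>R d)) = 0" unfolding t_def using foot_coherent d by blast
  have bx: "q (b - (c + t' *\<^sub>R d)) = 0" unfolding t'_def using foot_coherent d by blast
  let ?X = "\<phi> a - \<phi> c" and ?u = "\<phi> (c + t *\<^sub>R d) - \<phi> c" and ?u' = "\<phi> (c + t' *\<^sub>R d) - \<phi> c"
  have X: "q ?X \<noteq> 0" using c q_minus_commute unfolding noncoh_def by auto
  have u: "q ?u = 0" "q ?u' = 0" "q (?u - ?u') = 0"
    using coherent_ray[OF d(1), of c t 0] coherent_ray[OF d(1), of c t' 0] coherent_ray[OF d(1), of c t t'] by simp_all
  have Xu: "q (?X - ?u) = 0" "q (?X - ?u') = 0" using coherent[OF ax] coherent[OF bx] eq by simp_all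
  have XB: "q ?X = 2 * B ?X ?u" "q ?X = 2 * B ?X ?u'" using Xu u unfolding q_diff[of ?X] by simp_all
  have "?u \<noteq> 0" using Xu X by auto
  then obtain j where j: "?u' = j *\<^sub>R ?u" using null_triangle[OF u] by blast
  have "q ?X = j * q ?X" using XB unfolding j B.scaleR_right by simp
  then have "j = 1" using X by simp
  then have "\<phi> (c + t *\<^sub>R d) = \<phi> (c + t' *\<^sub>R d)" using j by simp
  then have "c + t *\<^sub>R d = c + t' *\<^sub>R d" by (rule inj_on_light_lines[rotated]) (use d in \<open>simp add: expand\<close>)
  moreover have "d \<noteq> 0" using d by auto
  ultimately have "t = t'" by simp
  then have "q ?p * B ?r d = q ?r * B ?p d" unfolding t_def t'_def using d by (simp add: field_simps)
  then have "B w d = 0" unfolding w_def B.diff_left[of "q ?p *\<^sub>R ?r"] B.scaleR_left by simp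
  then show False using d by simp
qed

lemma \<phi>_eq_iff: "\<phi> x = \<phi> y \<longleftrightarrow> x = y"
  using inj by (rule inj_eq)

section \<open>Reflection of coherency\<close>

lemma light_line_param:
  assumes "q d = 0" "d \<noteq> 0" "m \<noteq> 0" "m \<in> image_dir a d"
  obtains g :: "real \<Rightarrow> real" where "continuous_on UNIV g" "inj g" "\<And>t. \<phi> (a + t *\<^sub>R d) = \<phi> a + g t *\<^sub>R m"
proof -
  define g where "g t = inner (\<phi> (a + t *\<^sub>R d) - \<phi> a) m / inner m m" for t
  have g: "\<phi> (a + t *\<^sub>R d) = \<phi> a + g t *\<^sub>R m" for t
  proof -
    have "\<phi> (a + t *\<^sub>R d) - \<phi> a \<in> span {m}" using image_dir_eq_span assms image_dirI by metis
    then obtain k where k: "\<phi> (a + t *\<^sub>R d) - \<phi> a = k *\<^sub>R m" by (auto simp: span_singleton)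
    then have "g t = k" using assms by (simp add: g_def)
    then show ?thesis using k by (metis add.commute diff_add_cancel)
  qed
  have "continuous_on UNIV g" unfolding g_def using assms
    by (intro continuous_intros continuous_on_compose2[OF cont]) auto
  moreover have "inj g"
  proof (rule injI)
    fix s t assume "g s = g t"
    then have "\<phi> (a + s *\<^sub>R d) = \<phi> (a + t *\<^sub>R d)" using g by simp
    then show "s = t" using assms by (simp add: \<phi>_eq_iff)
  qed
  ultimately show thesis using that g by blast
qed

text \<open>If noncoherent \<open>a\<close>, \<open>b\<close> had coherent images, every light line
  through \<open>a\<close> not orthogonal to \<open>b - a\<close> would be mapped into the line
  through \<open>\<phi> a\<close> and \<open>\<phi> b\<close>. The images of two such lines are open
  intervals around \<open>\<phi> a\<close> and overlap, against injectivity.\<close>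

lemma coherent_reverse:
  assumes "q (\<phi> b - \<phi> a) = 0"
  shows "q (b - a) = 0"
proof (rule ccontr)
  assume nc: "q (b - a) \<noteq> 0"
  define m where "m = \<phi> b - \<phi> a"
  have "b - a \<noteq> 0" using nc by auto
  then have m0: "m \<noteq> 0" by (simp add: m_def \<phi>_eq_iff)
  have dirm: "m \<in> image_dir a d" if d: "q d = 0" "B (b - a) d \<noteq> 0" for d
  proof -
    let ?t = "q (b - a) / (2 * B (b - a) d)"
    have "d \<noteq> 0" using d by auto
    have t: "?t \<noteq> 0" using d nc by simp
    have "q (b - (a + ?t *\<^sub>R d)) = 0" using foot_coherent d by blast
    then have 1: "q ((\<phi> (a + ?t *\<^sub>R d) - \<phi> a) - m) = 0"
      unfolding m_def using coherent q_minus_commute[of "\<phi> b" "\<phi> (a + ?t *\<^sub>R d)"] by simp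
    have 2: "q (\<phi> (a + ?t *\<^sub>R d) - \<phi> a) = 0" using coherent_ray[OF d(1), of a ?t 0] by simp
    have 3: "\<phi> (a + ?t *\<^sub>R d) - \<phi> a \<noteq> 0" using t \<open>d \<noteq> 0\<close> by (simp add: \<phi>_eq_iff)
    obtain k where "m = k *\<^sub>R (\<phi> (a + ?t *\<^sub>R d) - \<phi> a)"
      using null_triangle[OF 2 _ 1 3] assms m_def by auto
    then show ?thesis using image_dirI[of a ?t d] by (simp add: image_dir_def span_scale)
  qed
  obtain d where d: "q d = 0" "B d (b - a) \<noteq> 0" using ex_generic_null \<open>b - a \<noteq> 0\<close> by blast
  then have d0: "d \<noteq> 0" by auto
  obtain d' where d': "q d' = 0" "B d' (b - a) \<noteq> 0" "B d' d \<noteq> 0"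
    using ex_generic_null2 \<open>b - a \<noteq> 0\<close> d0 by blast
  then have d'0: "d' \<noteq> 0" by auto
  have md: "m \<in> image_dir a d" "m \<in> image_dir a d'" using dirm d d' sym by metis+
  obtain g where g: "continuous_on UNIV g" "inj g" "\<And>t. \<phi> (a + t *\<^sub>R d) = \<phi> a + g t *\<^sub>R m"
    using light_line_param[OF d(1) d0 m0 md(1)] by blast
  obtain h where h: "continuous_on UNIV h" "inj h" "\<And>t. \<phi> (a + t *\<^sub>R d') = \<phi> a + h t *\<^sub>R m"
    using light_line_param[OF d'(1) d'0 m0 md(2)] by blast
  have "0 \<in> interior (range g)" "0 \<in> interior (range h)"
  proof -
    have "g 0 = 0" "h 0 = 0" using g(3)[of 0] h(3)[of 0] m0 by simp_all
    moreover have "open (range g)" "open (range h)"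
      using g h invariance_of_domain[of UNIV] by auto
    ultimately show "0 \<in> interior (range g)" "0 \<in> interior (range h)" by (metis interior_open rangeI)+
  qed
  then have "0 \<in> interior (range g \<inter> range h)" by simp
  then obtain \<epsilon> where \<epsilon>: "\<epsilon> > 0" "ball 0 \<epsilon> \<subseteq> range g \<inter> range h" unfolding mem_interior by blast
  then have "\<epsilon> / 2 \<in> range g \<inter> range h" by (intro subsetD[OF \<epsilon>(2)]) auto
  then obtain t t' where tt: "g t = \<epsilon> / 2" "h t' = \<epsilon> / 2" by auto
  then have "\<phi> (a + t *\<^sub>R d) = \<phi> (a + t' *\<^sub>R d')" using g h by simp
  then have "t *\<^sub>R d = t' *\<^sub>R d'" by (simp add: \<phi>_eq_iff)
  then have "B d' (t *\<^sub>R d) = B d' (t' *\<^sub>R d')" by simp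
  then have "t = 0" using d' by (simp add: B.scaleR_right)
  then show False using g(3)[of 0] tt \<epsilon> m0 by simp
qed

section \<open>Surjectivity and additivity\<close>

text \<open>
  The point \<open>a + v\<close> is a limit of points \<open>x t\<close> coherent to \<open>a + t d\<close>, both for \<open>t \<rightarrow> \<infinity>\<close> and for
  \<open>t \<rightarrow> -\<infinity>\<close>. If \<open>g\<close> had a finite limit \<open>G\<close>, the two limits together would force \<open>\<phi> (a + v)\<close> onto
  the light line through \<open>\<phi> a\<close>.
\<close>

lemma light_line_image_unbounded:
  assumes d: "q d = 0" "d \<noteq> 0" and m: "q m = 0" "m \<noteq> 0"
    and g: "\<And>t. \<phi> (a + t *\<^sub>R d) = \<phi> a + g t *\<^sub>R m" "strict_mono g"
  shows "\<not> bdd_above (range g)"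
proof
  assume bdd: "bdd_above (range g)"
  obtain h where h: "q h = 0" "B d h > 0" using ex_null_partner d by blast
  obtain v where v: "B d v = 0" "B h v = 0" "q v = - 2 * B d h" using ex_perp[OF d(1) h] by blast
  \<comment> \<open>The point coherent to \<open>a + t *\<^sub>R d\<close> on the light line through
    \<open>a + v\<close> in direction \<open>h\<close>.\<close>
  define x where "x t = a + v + (q v / (2 * t * B d h)) *\<^sub>R h" for t
  have x_coherent: "q (x t - (a + t *\<^sub>R d)) = 0" if "t \<noteq> 0" for t
  proof -
    have "q (v + s *\<^sub>R h - t *\<^sub>R d) = q v - 2 * s * t * B d h" for s
      using v(1,2) h(1) d(1) sym[of v d] sym[of v h] sym[of h d] by (simp add: expand)
    from this[of "q v / (2 * t * B d h)"] have "q (v + (q v / (2 * t * B d h)) *\<^sub>R h - t *\<^sub>R d) = 0"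
      using that h(2) by simp
    then show ?thesis by (simp add: x_def algebra_simps)
  qed
  have x_lim: "(\<lambda>k. x (T k)) \<longlonglongrightarrow> a + v" if "filterlim T at_infinity sequentially" for T :: "nat \<Rightarrow> real"
  proof -
    have "(\<lambda>k. a + v + ((q v / (2 * B d h)) * inverse (T k)) *\<^sub>R h) \<longlonglongrightarrow> a + v + ((q v / (2 * B d h)) * 0) *\<^sub>R h"
      by (intro tendsto_intros filterlim_compose[OF tendsto_inverse_0 that])
    then show ?thesis by (simp add: x_def field_simps)
  qed
  define G where "G = (SUP t. g t)"
  have gG: "g t \<le> G" for t unfolding G_def using bdd by (intro cSUP_upper) auto
  have Tplus: "filterlim (\<lambda>k. real (Suc k)) at_infinity sequentially"
    by (intro filterlim_at_top_imp_at_infinity filterlim_compose[OF filterlim_real_sequentially filterlim_Suc])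
  have Tminus: "filterlim (\<lambda>k. - real (Suc k)) at_infinity sequentially"
    by (intro filterlim_at_bot_imp_at_infinity filterlim_uminus_at_top[THEN iffD1]
        filterlim_compose[OF filterlim_real_sequentially filterlim_Suc])
  have gsup: "(\<lambda>k. g (real (Suc k))) \<longlonglongrightarrow> G"
  proof (rule increasing_tendsto)
    show "\<forall>\<^sub>F k in sequentially. g (real (Suc k)) \<le> G" using gG by simp
    fix y assume "y < G"
    then obtain t where t: "y < g t" unfolding G_def using bdd by (auto simp: less_cSUP_iff)
    obtain n where n: "real n \<ge> t" using real_arch_simple by blast
    show "\<forall>\<^sub>F k in sequentially. y < g (real (Suc k))"
      using eventually_ge_at_top[of n]
    proof eventually_elim
      case (elim k)
      then have "g t \<le> g (real (Suc k))" using n by (intro monoD[OF strict_mono_mono[OF g(2)]]) linarith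
      then show ?case using t by simp
    qed
  qed
  \<comment> \<open>The offset of \<open>\<phi> (a + v)\<close> from the supposed endpoint
    \<open>\<phi> a + G *\<^sub>R m\<close>; letting \<open>t\<close> tend to infinity shows that it
    is null.\<close>
  define Y where "Y = \<phi> (a + v) - \<phi> a - G *\<^sub>R m"
  have "(\<lambda>k. q (\<phi> (x (real (Suc k))) - \<phi> a - g (real (Suc k)) *\<^sub>R m)) \<longlonglongrightarrow> q Y"
    unfolding Y_def by (intro B.tendsto tendsto_intros tendsto_\<phi> x_lim Tplus gsup)
  moreover have "q (\<phi> (x (real (Suc k))) - \<phi> a - g (real (Suc k)) *\<^sub>R m) = 0" for k
    using coherent[OF x_coherent[of "real (Suc k)"]] g(1)[of "real (Suc k)"] by (simp add: diff_diff_eq)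
  ultimately have qY: "q Y = 0" by (simp add: LIMSEQ_const_iff)
  define Z where "Z k = \<phi> (x (- real (Suc k))) - \<phi> a - G *\<^sub>R m" for k
  have Zlim: "Z \<longlonglongrightarrow> Y" unfolding Z_def Y_def by (intro tendsto_intros tendsto_\<phi> x_lim Tminus)
  \<comment> \<open>Coherence at \<open>t = - real (Suc k)\<close> gives
    \<open>q (Z k) = - 2 c B (Z k) m\<close> with \<open>c \<ge> G - g 0 > 0\<close>; in the limit
    \<open>q Y = 0\<close> forces \<open>B Y m = 0\<close>.\<close>
  have "(2 * (G - g 0)) * \<bar>B (Z k) m\<bar> \<le> \<bar>q (Z k)\<bar>" for k
  proof -
    define c where "c = G - g (- real (Suc k))"
    have "Z k + c *\<^sub>R m = \<phi> (x (- real (Suc k))) - \<phi> (a + (- real (Suc k)) *\<^sub>R d)"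
      unfolding g(1)[of "- real (Suc k)"] Z_def c_def by (simp add: algebra_simps)
    then have "q (Z k + c *\<^sub>R m) = 0" using coherent[OF x_coherent[of "- real (Suc k)"]] by simp
    then have "q (Z k) = - (2 * c * B (Z k) m)"
      unfolding q_add[of "Z k"] q_scale m(1) B.scaleR_right[of "Z k"] by simp
    then have "\<bar>q (Z k)\<bar> = 2 * \<bar>c\<bar> * \<bar>B (Z k) m\<bar>" by (simp add: abs_mult)
    moreover have "g (- real (Suc k)) \<le> g 0" by (intro monoD[OF strict_mono_mono[OF g(2)]]) simp
    then have "G - g 0 \<le> \<bar>c\<bar>" by (simp add: c_def)
    ultimately show ?thesis by (simp add: mult_right_mono)
  qed
  moreover have "(\<lambda>k. (2 * (G - g 0)) * \<bar>B (Z k) m\<bar>) \<longlonglongrightarrow> (2 * (G - g 0)) * \<bar>B Y m\<bar>"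
    by (intro tendsto_intros B.tendsto Zlim)
  moreover have "(\<lambda>k. \<bar>q (Z k)\<bar>) \<longlonglongrightarrow> \<bar>q Y\<bar>" by (intro tendsto_intros B.tendsto Zlim)
  ultimately have "(2 * (G - g 0)) * \<bar>B Y m\<bar> \<le> \<bar>q Y\<bar>" by (meson LIMSEQ_le)
  moreover have "g 0 < G" using gG[of 1] strict_monoD[OF g(2), of 0 1] by simp
  ultimately have "B m Y = 0" using qY sym[of m Y] by (simp add: mult_le_0_iff)
  then obtain k where "Y = k *\<^sub>R m" using null_parallel[OF m(1) qY _ m(2)] by blast
  then have "\<phi> (a + v) - \<phi> a = (k + G) *\<^sub>R m" unfolding Y_def by (simp add: algebra_simps)
  then have "q (\<phi> (a + v) - \<phi> a) = 0" using m by (simp add: q_scale)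
  then have "q (a + v - a) = 0" by (rule coherent_reverse)
  then show False using v h by simp
qed

text \<open>The image has a monotone parameter \<open>g\<close>.
  \<open>light_line_image_unbounded\<close>, applied also to the reversed line with
  \<open>- m\<close>, excludes bounds on both sides, and connectedness yields the value
  \<open>1\<close>.\<close>

lemma light_line_onto:
  assumes d: "q d = 0" "d \<noteq> 0" and m: "m \<noteq> 0" "m \<in> image_dir a d"
  obtains t where "\<phi> (a + t *\<^sub>R d) = \<phi> a + m"
proof -
  obtain g where g: "continuous_on UNIV g" "inj g" "\<And>t. \<phi> (a + t *\<^sub>R d) = \<phi> a + g t *\<^sub>R m"
    using light_line_param[OF d m] by blast
  have qm: "q m = 0"
  proof -
    obtain m' where "q m' = 0" "image_dir a d = span {m'}" using image_dir_generator d by blast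
    then show ?thesis using m(2) by (auto simp: span_singleton q_scale)
  qed
  have unbounded: "\<not> bdd_above (range h) \<and> \<not> bdd_below (range h)"
    if h: "\<And>t. \<phi> (a + t *\<^sub>R e) = \<phi> a + h t *\<^sub>R m" "strict_mono h" and e: "q e = 0" "e \<noteq> 0" for h e
  proof
    show "\<not> bdd_above (range h)" using light_line_image_unbounded[OF e qm m(1) h] .
    have "\<not> bdd_above (range (\<lambda>t. - h (- t)))"
    proof (rule light_line_image_unbounded)
      show "q (- e) = 0" "- e \<noteq> 0" "q (- m) = 0" "- m \<noteq> 0" using e qm m by (simp_all add: expand)
      show "\<phi> (a + t *\<^sub>R - e) = \<phi> a + (- h (- t)) *\<^sub>R - m" for t using h(1)[of "- t"] by simp
      show "strict_mono (\<lambda>t. - h (- t))" using h(2) by (auto simp: strict_mono_def)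
    qed
    moreover have "bdd_above (range (\<lambda>t. - h (- t)))" if below: "bdd_below (range h)"
    proof -
      obtain c where "\<And>t. c \<le> h t" using below unfolding bdd_below_def by blast
      then show ?thesis by (intro bdd_aboveI[of _ "- c"]) auto
    qed
    ultimately show "\<not> bdd_below (range h)" by metis
  qed
  have "\<not> bdd_above (range g) \<and> \<not> bdd_below (range g)"
  proof -
    have "strict_mono g \<or> strict_antimono_on UNIV g"
      using injective_eq_monotone_map[of UNIV g] g by simp
    then show ?thesis
    proof
      assume "strict_mono g" then show ?thesis by (rule unbounded[OF g(3) _ d])
    next
      assume "strict_antimono_on UNIV g"
      then have mono: "strict_mono (\<lambda>t. g (- t))" by (auto simp: monotone_on_def)
      have param: "\<phi> (a + t *\<^sub>R - d) = \<phi> a + g (- t) *\<^sub>R m" for t using g(3)[of "- t"] by simp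
      have "q (- d) = 0" "- d \<noteq> 0" using d by (simp_all add: expand)
      then have "\<not> bdd_above (range (\<lambda>t. g (- t))) \<and> \<not> bdd_below (range (\<lambda>t. g (- t)))"
        by (rule unbounded[OF param mono])
      moreover have "range (\<lambda>t. g (- t)) = range g"
        using image_comp[of g uminus UNIV] by (simp add: o_def)
      ultimately show ?thesis by simp
    qed
  qed
  then obtain s t where "g s \<le> 1" "1 \<le> g t"
    unfolding bdd_above_def bdd_below_def by (metis rangeE nle_le)
  moreover have "connected (range g)" using g(1) connected_UNIV by (intro connected_continuous_image)
  ultimately have "1 \<in> range g" using connectedD_interval by blast
  then obtain t where "g t = 1" by auto
  then show thesis using that g(3)[of t] by simp
qed

text \<open>The range is open by invariance of domain, so it contains a short step from
  \<open>\<phi> a\<close> along any light line; \<open>coherent_reverse\<close> and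
  \<open>light_line_onto\<close> extend this to the whole line, and two null steps reach every
  point.\<close>

lemma surj: "surj \<phi>"
proof -
  have op: "open (range \<phi>)" using invariance_of_domain[OF cont open_UNIV] inj by simp
  have cone: "\<phi> a + m \<in> range \<phi>" if m: "q m = 0" for a m
  proof (cases "m = 0")
    case False
    have "((\<lambda>t. \<phi> a + t *\<^sub>R m) \<longlongrightarrow> \<phi> a + 0 *\<^sub>R m) (at (0::real))" by (intro tendsto_intros)
    then have "\<forall>\<^sub>F t in at 0. \<phi> a + t *\<^sub>R m \<in> range \<phi>" using op by (intro topological_tendstoD) auto
    moreover have "\<forall>\<^sub>F t::real in at 0. t \<noteq> 0" by (simp add: eventually_at_filter)
    ultimately have "\<forall>\<^sub>F t in at 0. \<phi> a + t *\<^sub>R m \<in> range \<phi> \<and> t \<noteq> 0" by eventually_elim auto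
    then obtain t where t0: "t \<noteq> 0" "\<phi> a + t *\<^sub>R m \<in> range \<phi>"
      using eventually_happens'[OF at_neq_bot] by blast
    then obtain x where x: "\<phi> a + t *\<^sub>R m = \<phi> x" by blast
    note t = t0(1) x[symmetric]
    have "q (x - a) = 0" by (rule coherent_reverse) (use t m in \<open>simp add: q_scale\<close>)
    moreover have "x - a \<noteq> 0" using t False by auto
    moreover have "m \<in> image_dir a (x - a)"
    proof -
      have "m = inverse t *\<^sub>R (\<phi> x - \<phi> a)" using t by simp
      then show ?thesis using image_dirI1[of x a] by (simp add: image_dir_def span_scale)
    qed
    ultimately show ?thesis using light_line_onto False by (metis rangeI)
  qed simp
  have "y \<in> range \<phi>" for y
  proof -
    obtain d d' where d: "y - \<phi> 0 = d + d'" "q d = 0" "q d' = 0" using ex_null_sum by blast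
    then obtain x where "\<phi> x = \<phi> 0 + d" using cone by (metis rangeE)
    then have "y = \<phi> x + d'" using d by (simp add: algebra_simps)
    then show ?thesis using cone d by simp
  qed
  then show ?thesis by auto
qed

text \<open>A point \<open>x\<close> with \<open>B (x - a) d \<noteq> 0\<close> is coherent to a
  point of \<open>a + \<real>d\<close>. If its image were in the hyperplane orthogonal to
  \<open>m\<close>, it would lie on the image line, which is already filled by
  \<open>a + \<real>d\<close>.\<close>

lemma null_hyperplane_subset_image:
  assumes d: "q d = 0" "d \<noteq> 0" and m: "m \<noteq> 0" "q m = 0" "image_dir a d = span {m}" and y: "B (y - \<phi> a) m = 0"
  obtains x where "\<phi> x = y" "B (x - a) d = 0"
proof -
  obtain x where x: "\<phi> x = y" using surj by (metis surjD)
  have "B (x - a) d = 0"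
  proof (rule ccontr)
    assume nz: "B (x - a) d \<noteq> 0"
    let ?t = "q (x - a) / (2 * B (x - a) d)"
    have "q (x - (a + ?t *\<^sub>R d)) = 0" using foot_coherent d nz by blast
    then have 1: "q (y - \<phi> (a + ?t *\<^sub>R d)) = 0" using coherent x by blast
    obtain k where k: "\<phi> (a + ?t *\<^sub>R d) - \<phi> a = k *\<^sub>R m"
      using image_dirI[of a ?t d] m(3) by (auto simp: span_singleton)
    have k': "y - \<phi> (a + ?t *\<^sub>R d) = (y - \<phi> a) - k *\<^sub>R m" unfolding k[symmetric] by simp
    have "B m (y - \<phi> (a + ?t *\<^sub>R d)) = 0" unfolding k' using y m(2) sym[of m "y - \<phi> a"]
      by (simp add: B.diff_right[of m "y - \<phi> a"] B.scaleR_right)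
    then obtain j where j: "y - \<phi> (a + ?t *\<^sub>R d) = j *\<^sub>R m" using null_parallel[OF m(2) 1 _ m(1)] by blast
    then have yk: "y = \<phi> a + (k + j) *\<^sub>R m" using k' by (simp add: algebra_simps)
    have "\<exists>t. \<phi> (a + t *\<^sub>R d) = y"
    proof (cases "k + j = 0")
      case True then show ?thesis using yk by (intro exI[of _ 0]) simp
    next
      case False
      moreover have "(k + j) *\<^sub>R m \<in> image_dir a d" using m(3) by (auto simp: span_singleton)
      ultimately show ?thesis using light_line_onto[OF d, of "(k + j) *\<^sub>R m" a] m(1) yk by force
    qed
    then obtain t where "x = a + t *\<^sub>R d" using x \<phi>_eq_iff by metis
    then show False using nz d by (simp add: B.scaleR_left)
  qed
  then show thesis using that x by blast
qed

text \<open>For \<open>B (b - a) d \<noteq> 0\<close> the null hyperplanes at \<open>a\<close> and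
  \<open>b\<close> are disjoint, hence so are those at \<open>\<phi> a\<close> and
  \<open>\<phi> b\<close>, which would meet if \<open>B m n \<noteq> 0\<close>. Otherwise a point
  outside the common hyperplane mediates.\<close>

lemma image_dir_independent:
  assumes d: "q d = 0" "d \<noteq> 0"
  shows "image_dir a d = image_dir b d"
proof -
  have *: "image_dir a d = image_dir b d" if ab: "B (b - a) d \<noteq> 0" for a b
  proof -
    obtain m where m: "m \<noteq> 0" "q m = 0" "image_dir a d = span {m}" using image_dir_generator d by blast
    obtain n where n: "n \<noteq> 0" "q n = 0" "image_dir b d = span {n}" using image_dir_generator d by blast
    have "B m n = 0"
    proof (rule ccontr)
      assume mn: "B m n \<noteq> 0"
      \<comment> \<open>A common point of both image hyperplanes, sought in the plane of
        \<open>m\<close> and \<open>n\<close>.\<close>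
      define y where "y = (B (\<phi> b) n / B m n) *\<^sub>R m + (B (\<phi> a) m / B m n) *\<^sub>R n"
      have "B (y - \<phi> a) m = 0" "B (y - \<phi> b) n = 0"
        unfolding y_def using m(2) n(2) mn sym[of n m] by (simp_all add: expand)
      then obtain x x' where "\<phi> x = y" "B (x - a) d = 0" "\<phi> x' = y" "B (x' - b) d = 0"
        using null_hyperplane_subset_image[OF d m] null_hyperplane_subset_image[OF d n] by metis
      then have "B (x - a) d = 0" "B (x - b) d = 0" using \<phi>_eq_iff by metis+
      then show False using ab by (simp add: B.diff_left)
    qed
    then obtain k where k: "n = k *\<^sub>R m" using null_parallel m n by blast
    then have "n \<in> image_dir a d" using m(3) by (auto simp: span_singleton)
    then show ?thesis using image_dir_eq_span d n by metis
  qed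
  show ?thesis
  proof (cases "B (b - a) d = 0")
    case True
    obtain c where c: "B (c - a) d \<noteq> 0" using ex_nonorthogonal_near[of UNIV 0 d a] d by auto
    then have "B (c - b) d \<noteq> 0" using True by (simp add: B.diff_left)
    then show ?thesis using * c by metis
  qed (use * in blast)
qed

text \<open>Image directions depend only on the direction of the light line, so the parallelogram on
  \<open>v\<close> and \<open>w\<close> goes to a quadrilateral with sides along \<open>m\<close>
  and \<open>n\<close>; as \<open>B m n \<noteq> 0\<close>, opposite sides agree.\<close>

lemma increment_shift:
  assumes "q v = 0" "q w = 0" "B v w \<noteq> 0"
  shows "\<phi> (a + w + v) - \<phi> (a + w) = \<phi> (a + v) - \<phi> a"
proof -
  have v0: "v \<noteq> 0" and w0: "w \<noteq> 0" using assms by auto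
  define m n where "m = \<phi> (0 + v) - \<phi> 0" and "n = \<phi> (0 + w) - \<phi> 0"
  have m0: "m \<noteq> 0" and n0: "n \<noteq> 0" using v0 w0 by (simp_all add: m_def n_def \<phi>_eq_iff)
  have dm: "image_dir b v = span {m}" for b
    using image_dir_independent[OF assms(1) v0, of b 0] image_dir_eq_span[OF assms(1) _ m0, of 0]
      image_dirI[of 0 1 v] by (simp add: m_def)
  have dn: "image_dir b w = span {n}" for b
    using image_dir_independent[OF assms(2) w0, of b 0] image_dir_eq_span[OF assms(2) _ n0, of 0]
      image_dirI[of 0 1 w] by (simp add: n_def)
  have mm: "\<exists>k. \<phi> (b + v) - \<phi> b = k *\<^sub>R m" for b using dm image_dirI[of b 1 v] by (auto simp: span_singleton)
  have nn: "\<exists>k. \<phi> (b + w) - \<phi> b = k *\<^sub>R n" for b using dn image_dirI[of b 1 w] by (auto simp: span_singleton)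
  have qm: "q m = 0" and qn: "q n = 0" unfolding m_def n_def using assms by (auto intro!: coherent)
  have "q (v - w) \<noteq> 0" using assms by (simp add: q_diff)
  then have "q (m - n) \<noteq> 0" using coherent_reverse[of v w] by (auto simp: m_def n_def)
  then have Bmn: "B m n \<noteq> 0" using qm qn by (simp add: q_diff)
  obtain k1 k2 j1 j2 where k: "\<phi> (a + w + v) - \<phi> (a + w) = k1 *\<^sub>R m" "\<phi> (a + v) - \<phi> a = k2 *\<^sub>R m"
    "\<phi> (a + v + w) - \<phi> (a + v) = j1 *\<^sub>R n" "\<phi> (a + w) - \<phi> a = j2 *\<^sub>R n"
    using mm nn by metis
  have "(k1 - k2) *\<^sub>R m = (j1 - j2) *\<^sub>R n"
    unfolding scaleR_diff_left k[symmetric] by (simp add: add.commute add.left_commute)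
  then have "B ((k1 - k2) *\<^sub>R m) n = B ((j1 - j2) *\<^sub>R n) n" by simp
  then have "k1 = k2" using Bmn qn by (simp add: B.scaleR_left)
  then show ?thesis using k by simp
qed

lemma increment_const:
  assumes v: "q v = 0"
  shows "\<phi> (a + v) - \<phi> a = \<phi> v - \<phi> 0"
proof (cases "v = 0")
  case False
  \<comment> \<open>The translations that preserve increments along \<open>v\<close>. They are
    closed under addition, so it suffices to generate every vector from null vectors not orthogonal
    to \<open>v\<close>.\<close>
  define T where "T = {w. \<forall>a. \<phi> (a + w + v) - \<phi> (a + w) = \<phi> (a + v) - \<phi> a}"
  have add: "w + w' \<in> T" if "w \<in> T" "w' \<in> T" for w w'
    using that unfolding T_def by (auto simp: add.assoc[symmetric])
  have gen: "w \<in> T" if "q w = 0" "B v w \<noteq> 0" for w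
    using increment_shift[OF v that] by (simp add: T_def)
  obtain h where h: "q h = 0" "B v h > 0" using ex_null_partner v False by blast
  obtain u where u: "B v u = 0" "B h u = 0" "q u = - 2 * B v h" using ex_perp[OF v h] by blast
  \<comment> \<open>Multiples of \<open>v\<close> arise as
    \<open>k v = (k/2) (v + u + h) + (k/2) (v - u + h) - k h\<close>, whose summands are null and
    not orthogonal to \<open>v\<close>.\<close>
  have par: "k *\<^sub>R v \<in> T" if "k \<noteq> 0" for k
  proof -
    have "(k / 2) *\<^sub>R (v + \<sigma> *\<^sub>R u + h) \<in> T" if "\<sigma> = 1 \<or> \<sigma> = - 1" for \<sigma> :: real
    proof (rule gen)
      show "q ((k / 2) *\<^sub>R (v + \<sigma> *\<^sub>R u + h)) = 0"
        unfolding q_scale q_add q_scale using v h(1) u(1,2) sym[of u h] u(3) that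
        by (auto simp: expand)
      show "B v ((k / 2) *\<^sub>R (v + \<sigma> *\<^sub>R u + h)) \<noteq> 0"
        using \<open>k \<noteq> 0\<close> v h u by (simp add: expand)
    qed
    from this[of 1] this[of "-1"] have "(k / 2) *\<^sub>R (v + u + h) \<in> T" "(k / 2) *\<^sub>R (v - u + h) \<in> T" by simp_all
    moreover have "(- k) *\<^sub>R h \<in> T" using gen[of "(- k) *\<^sub>R h"] \<open>k \<noteq> 0\<close> h by (simp add: expand)
    ultimately have "(k / 2) *\<^sub>R (v + u + h) + (k / 2) *\<^sub>R (v - u + h) + (- k) *\<^sub>R h \<in> T" using add by blast
    also have "(k / 2) *\<^sub>R (v + u + h) + (k / 2) *\<^sub>R (v - u + h) + (- k) *\<^sub>R h = (k / 2 + k / 2) *\<^sub>R v + (k / 2 + k / 2 - k) *\<^sub>R h"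
      by (simp only: scaleR_add_right scaleR_diff_right scaleR_add_left scaleR_diff_left scaleR_minus_left) simp
    finally show ?thesis by simp
  qed
  have null: "w \<in> T" if "q w = 0" for w
  proof (cases "B v w = 0")
    case True
    then have "\<exists>k. w = k *\<^sub>R v" using null_parallel v \<open>q w = 0\<close> False by blast
    then obtain k where "w = k *\<^sub>R v" by blast
    then show ?thesis using par[of k] by (cases "k = 0") (auto simp: T_def)
  qed (use gen that in blast)
  obtain d d' where "a = d + d'" "q d = 0" "q d' = 0" using ex_null_sum by blast
  then have "a \<in> T" using add null by simp
  then have "\<phi> (0 + a + v) - \<phi> (0 + a) = \<phi> (0 + v) - \<phi> 0" unfolding T_def by blast
  then show ?thesis by simp
qed simp

lemma additive: "\<phi> (x + y) - \<phi> 0 = (\<phi> x - \<phi> 0) + (\<phi> y - \<phi> 0)"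
proof -
  obtain d d' where d: "y = d + d'" "q d = 0" "q d' = 0" using ex_null_sum by blast
  have "\<phi> (z + y) = \<phi> z + (\<phi> d - \<phi> 0) + (\<phi> d' - \<phi> 0)" for z
    using increment_const[OF d(3), of "z + d"] increment_const[OF d(2), of z] d(1)
    by (simp add: algebra_simps)
  from this[of x] this[of 0] show ?thesis by simp
qed

end

section \<open>From additive to affine\<close>

lemma continuous_additive_imp_linear:
  fixes f :: "'a::real_normed_vector \<Rightarrow> 'b::real_normed_vector"
  assumes add: "\<And>x y. f (x + y) = f x + f y" and cont: "continuous_on UNIV f"
  shows "linear f"
proof (rule linearI[OF add])
  fix r x
  have f0: "f 0 = 0" using add[of 0 0] by simp
  have minus: "f (- y) = - f y" for y using add[of y "- y"] f0 by (simp add: minus_unique)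
  have nat: "f (real n *\<^sub>R y) = real n *\<^sub>R f y" for n y
    by (induction n) (simp_all add: f0 add scaleR_add_left)
  have int: "f (real_of_int n *\<^sub>R y) = real_of_int n *\<^sub>R f y" for n y
    using nat by (cases n rule: int_cases2) (simp_all add: minus)
  have rat: "f (t *\<^sub>R x) = t *\<^sub>R f x" if t: "t \<in> \<rat>" for t
  proof -
    obtain m n where mn: "n > 0" "t = real_of_int m / real_of_int n"
      using t by (auto elim!: Rats_cases')
    have "real_of_int n *\<^sub>R f (t *\<^sub>R x) = real_of_int m *\<^sub>R f x"
      using int[of n "t *\<^sub>R x"] int[of m x] mn by simp
    also have "\<dots> = real_of_int n *\<^sub>R t *\<^sub>R f x" using mn by simp
    finally show ?thesis using mn(1) by (metis scaleR_cancel_left of_int_eq_0_iff less_irrefl)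
  qed
  have "closed {t. f (t *\<^sub>R x) = t *\<^sub>R f x}"
    by (intro closed_Collect_eq continuous_intros continuous_on_compose2[OF cont]) auto
  then have "closure \<rat> \<subseteq> {t. f (t *\<^sub>R x) = t *\<^sub>R f x}" using rat by (intro closure_minimal) auto
  then show "f (r *\<^sub>R x) = r *\<^sub>R f x" using Rats_closure_real by auto
qed

context nondegenerate_preserver
begin

theorem affine_similarity: "affine_similarity q \<phi>"
proof -
  define u where "u x = \<phi> x - \<phi> 0" for x
  have lin: "linear u"
    unfolding u_def using additive by (intro continuous_additive_imp_linear continuous_intros cont) auto
  have "bij u"
  proof (rule bijI)
    show "inj u" using \<phi>_eq_iff by (auto simp: inj_def u_def)
    show "surj u"
    proof (rule surjI)
      show "u (inv \<phi> (y + \<phi> 0)) = y" for y unfolding u_def using surj by (simp add: surj_f_inv_f)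
    qed
  qed
  moreover obtain l where l: "\<And>x. q (u x) = l * q x"
    using null_preserving_imp_similarity[OF lin] coherent[of _ 0] by (auto simp: u_def)
  \<comment> \<open>With \<open>l = 0\<close> the whole range would lie in the cone of
    \<open>\<phi> 0\<close>.\<close>
  moreover have "l \<noteq> 0"
  proof
    assume "l = 0"
    then have "q (\<phi> x - \<phi> 0) = 0" for x using l[of x] by (simp add: u_def)
    then show False using ex_noncoherent by blast
  qed
  ultimately have "linear_similarity q u" unfolding linear_similarity_def using lin by blast
  moreover have "\<phi> = (\<lambda>x. u x + \<phi> 0)" by (simp add: u_def)
  ultimately show ?thesis unfolding affine_similarity_def by (intro exI conjI)
qed

end

theorem theorem1p2:
  fixes q :: "'v::euclidean_space \<Rightarrow> real" and \<phi> :: "'v \<Rightarrow> 'v"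
  assumes "DIM('v) = 4"
    and "minkowski_form q"
    and "continuous_on UNIV \<phi>"
    and "coherency_preserver q \<phi>"
  shows "affine_similarity q \<phi> \<or> degenerate q \<phi>"
proof (rule disjCI)
  assume nondeg: "\<not> degenerate q \<phi>"
  have "DIM('v) \<ge> 3" using assms(1) by simp
  then obtain B where B: "minkowski_space B" and qB: "\<And>x. q x = B x x"
    using minkowski_form_imp_minkowski_space[OF _ assms(2)] by metis
  have "q = (\<lambda>x. B x x)" using qB by auto
  moreover have "nondegenerate_preserver B \<phi>"
  proof (intro nondegenerate_preserver.intro B nondegenerate_preserver_axioms.intro assms(3))
    show "B (\<phi> b - \<phi> a) (\<phi> b - \<phi> a) = 0" if "B (b - a) (b - a) = 0" for a b
      using assms(4) that by (simp add: coherency_preserver_def qB)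
    show "\<exists>b. B (\<phi> b - \<phi> a) (\<phi> b - \<phi> a) \<noteq> 0" for a
      using nondeg by (auto simp: degenerate_def coherency_cone_def qB image_subset_iff)
  qed
  ultimately show "affine_similarity q \<phi>"
    using nondegenerate_preserver.affine_similarity by metis
qed

end
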